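(* Let $(\Omega,\Sigma,\mu)$ be a non-atomic $\sigma$-finite complete measure space, $\Gamma\subset\Omega$ a measurable set with $\mu(\Gamma)>0$, and let $v,w\in L_0(\Omega)$ be weight functions on $\Gamma$ and $\Omega$, respectively. Let $X=L_{1,w}(\Omega)\cap L_{\infty,v}(\Gamma)=\{x\in L_0: x\in L_{1,w}(\Omega)\text{ and }x\chi_\Gamma\in L_{\infty,v}(\Gamma)\}$ be equipped with the norm $\|x\|=\|x\|_{w,v}=\max\{\|x\|_{1,w},\|x\chi_\Gamma\|_{\infty,v}\}$. The following conditions are equivalent. (i) $X$ has the Daugavet property. (ii) $X=L_{\infty,v}$ (that is, $X=L_{\infty,v}(\Omega)$ as sets with equality of norms). (iii) $\mu(\Omega\setminus\Gamma)=0$ and $\int_\Omega w/v\,d\mu\le1$.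
   Context: All Banach spaces are real. A Banach space $X$ has the Daugavet property if $\|I+T\|=1+\|T\|$ for every rank one bounded linear operator $T:X\to X$. $L_0=L_0(\Omega)$ is the set of ($\mu$-a.e. equivalence classes of) measurable extended-real valued functions on $\Omega$. A function $u\in L_0(\Omega)$ is a weight function on a measurable set $\Gamma\subset\Omega$ if $0<u<\infty$ $\mu$-a.e. on $\Gamma$. $L_{1,u}(\Gamma)=\{x\in L_0: x=0\ \mu\text{-a.e. off }\Gamma,\ \|x\|_{1,u}=\int_\Gamma|xu|\,d\mu<\infty\}$, and $L_{\infty,u}(\Gamma)=\{x\in L_0:x=0\ \mu\text{-a.e. off }\Gamma,\ \|x\|_{\infty,u}=\operatorname{ess\,sup}_{t\in\Gamma}|x(t)u(t)|<\infty\}$; $L_{\infty,u}=L_{\infty,u}(\Omega)$. Note that in $X$ no $L_\infty$ condition is imposed on $\Omega\setminus\Gamma$. In (ii), the equality includes that $v$ is a weight function on $\Omega$. *)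

theory Defs
  imports "HOL-Probability.Essential_Supremum"
begin

section \<open>Real normed spaces given by a carrier set\<close>

text \<open>The function spaces below depend on a measure, so they cannot be types of class
  \<^class>\<open>real_normed_vector\<close>.  Only the behaviour of the operations on \<open>vecs\<close> matters.\<close>

record 'b normed_sp =
  vecs :: "'b set"
  vzero :: 'b
  vadd :: "'b \<Rightarrow> 'b \<Rightarrow> 'b"
  vscale :: "real \<Rightarrow> 'b \<Rightarrow> 'b"
  vnorm :: "'b \<Rightarrow> real"

definition bounded_operator :: "('b, 'm) normed_sp_scheme \<Rightarrow> ('b \<Rightarrow> 'b) \<Rightarrow> bool" where
  "bounded_operator X T \<longleftrightarrow>
     (\<forall>x\<in>vecs X. T x \<in> vecs X) \<and>
     (\<forall>x\<in>vecs X. \<forall>y\<in>vecs X. T (vadd X x y) = vadd X (T x) (T y)) \<and>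
     (\<forall>c. \<forall>x\<in>vecs X. T (vscale X c x) = vscale X c (T x)) \<and>
     (\<exists>K. \<forall>x\<in>vecs X. vnorm X (T x) \<le> K * vnorm X x)"

definition rank_one :: "('b, 'm) normed_sp_scheme \<Rightarrow> ('b \<Rightarrow> 'b) \<Rightarrow> bool" where
  "rank_one X T \<longleftrightarrow>
     (\<exists>y\<in>vecs X. y \<noteq> vzero X \<and> T ` vecs X = range (\<lambda>c. vscale X c y))"

definition operator_norm :: "('b, 'm) normed_sp_scheme \<Rightarrow> ('b \<Rightarrow> 'b) \<Rightarrow> real" where
  "operator_norm X T = (SUP x\<in>{x \<in> vecs X. vnorm X x \<le> 1}. vnorm X (T x))"

definition Daugavet_property :: "('b, 'm) normed_sp_scheme \<Rightarrow> bool" where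
  "Daugavet_property X \<longleftrightarrow>
     (\<forall>T. bounded_operator X T \<and> rank_one X T \<longrightarrow>
        operator_norm X (\<lambda>x. vadd X x (T x)) = 1 + operator_norm X T)"

section \<open>Non-atomic measures\<close>

definition atom :: "'a measure \<Rightarrow> 'a set \<Rightarrow> bool" where
  "atom M A \<longleftrightarrow> A \<in> sets M \<and> emeasure M A > 0 \<and>
     (\<forall>B\<in>sets M. B \<subseteq> A \<longrightarrow> emeasure M B = 0 \<or> emeasure M (A - B) = 0)"

definition non_atomic :: "'a measure \<Rightarrow> bool" where
  "non_atomic M \<longleftrightarrow> (\<nexists>A. atom M A)"

section \<open>Classes of measurable extended-real valued functions\<close>

definition AE_rel :: "'a measure \<Rightarrow> (('a \<Rightarrow> ereal) \<times> ('a \<Rightarrow> ereal)) set" where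
  "AE_rel M = {(f, g). f \<in> borel_measurable M \<and> g \<in> borel_measurable M \<and> (AE t in M. f t = g t)}"

definition L0_class :: "'a measure \<Rightarrow> ('a \<Rightarrow> ereal) \<Rightarrow> ('a \<Rightarrow> ereal) set" where
  "L0_class M f = AE_rel M `` {f}"

text \<open>The value on a class of a function \<open>F\<close> that is constant on each class.\<close>

definition L0_lift :: "(('a \<Rightarrow> ereal) \<Rightarrow> 'b) \<Rightarrow> ('a \<Rightarrow> ereal) set \<Rightarrow> 'b" where
  "L0_lift F x = the_elem (F ` x)"

text \<open>All elements of the spaces below are finite almost everywhere, so the convention
  for \<open>\<infinity> - \<infinity>\<close> in \<^typ>\<open>ereal\<close> plays no role in the sum.\<close>

definition L0_add ::
    "'a measure \<Rightarrow> ('a \<Rightarrow> ereal) set \<Rightarrow> ('a \<Rightarrow> ereal) set \<Rightarrow> ('a \<Rightarrow> ereal) set" where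
  "L0_add M x y = (\<Union>f\<in>x. \<Union>g\<in>y. L0_class M (\<lambda>t. f t + g t))"

definition L0_scale :: "'a measure \<Rightarrow> real \<Rightarrow> ('a \<Rightarrow> ereal) set \<Rightarrow> ('a \<Rightarrow> ereal) set" where
  "L0_scale M c x = (\<Union>f\<in>x. L0_class M (\<lambda>t. ereal c * f t))"

section \<open>Weighted spaces\<close>

text \<open>Weights enter through measurable representatives; everything below depends only on their
  classes modulo equality almost everywhere.\<close>

definition weight_on :: "'a measure \<Rightarrow> 'a set \<Rightarrow> ('a \<Rightarrow> ereal) \<Rightarrow> bool" where
  "weight_on M \<Gamma> u \<longleftrightarrow> u \<in> borel_measurable M \<and> (AE t in M. t \<in> \<Gamma> \<longrightarrow> 0 < u t \<and> u t < \<infinity>)"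

definition restr :: "'a set \<Rightarrow> ('a \<Rightarrow> ereal) \<Rightarrow> 'a \<Rightarrow> ereal" where
  "restr \<Gamma> f = (\<lambda>t. f t * indicator \<Gamma> t)"

definition L1_norm :: "'a measure \<Rightarrow> 'a set \<Rightarrow> ('a \<Rightarrow> ereal) \<Rightarrow> ('a \<Rightarrow> ereal) \<Rightarrow> ennreal" where
  "L1_norm M \<Gamma> u f = (\<integral>\<^sup>+ t\<in>\<Gamma>. e2ennreal \<bar>f t * u t\<bar> \<partial>M)"

definition Linf_norm :: "'a measure \<Rightarrow> 'a set \<Rightarrow> ('a \<Rightarrow> ereal) \<Rightarrow> ('a \<Rightarrow> ereal) \<Rightarrow> ennreal" where
  "Linf_norm M \<Gamma> u f = esssup (restrict_space M \<Gamma>) (\<lambda>t. e2ennreal \<bar>f t * u t\<bar>)"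

definition L1_set :: "'a measure \<Rightarrow> 'a set \<Rightarrow> ('a \<Rightarrow> ereal) \<Rightarrow> ('a \<Rightarrow> ereal) set set" where
  "L1_set M \<Gamma> u = {L0_class M f | f. f \<in> borel_measurable M \<and>
     (AE t in M. t \<notin> \<Gamma> \<longrightarrow> f t = 0) \<and> L1_norm M \<Gamma> u f < \<infinity>}"

definition Linf_set :: "'a measure \<Rightarrow> 'a set \<Rightarrow> ('a \<Rightarrow> ereal) \<Rightarrow> ('a \<Rightarrow> ereal) set set" where
  "Linf_set M \<Gamma> u = {L0_class M f | f. f \<in> borel_measurable M \<and>
     (AE t in M. t \<notin> \<Gamma> \<longrightarrow> f t = 0) \<and> Linf_norm M \<Gamma> u f < \<infinity>}"

definition Linf_space ::
    "'a measure \<Rightarrow> 'a set \<Rightarrow> ('a \<Rightarrow> ereal) \<Rightarrow> ('a \<Rightarrow> ereal) set normed_sp" where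
  "Linf_space M \<Gamma> u =
    \<lparr> vecs = Linf_set M \<Gamma> u,
      vzero = L0_class M (\<lambda>_. 0),
      vadd = L0_add M,
      vscale = L0_scale M,
      vnorm = L0_lift (\<lambda>f. enn2real (Linf_norm M \<Gamma> u f)) \<rparr>"

definition L1_inter_Linf ::
    "'a measure \<Rightarrow> 'a set \<Rightarrow> ('a \<Rightarrow> ereal) \<Rightarrow> ('a \<Rightarrow> ereal) \<Rightarrow> ('a \<Rightarrow> ereal) set normed_sp" where
  "L1_inter_Linf M \<Gamma> w v =
    \<lparr> vecs = {L0_class M f | f. f \<in> borel_measurable M \<and>
                L0_class M f \<in> L1_set M (space M) w \<and>
                L0_class M (restr \<Gamma> f) \<in> Linf_set M \<Gamma> v},
      vzero = L0_class M (\<lambda>_. 0),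
      vadd = L0_add M,
      vscale = L0_scale M,
      vnorm = L0_lift (\<lambda>f. max (enn2real (L1_norm M (space M) w f))
                               (enn2real (Linf_norm M \<Gamma> v (restr \<Gamma> f)))) \<rparr>"

end

theory Submission
  imports Defs
begin

text \<open>Dividing by weights turns the problem into one about real functions.  Write a class in the
  intersection space as \<open>[g / w]\<close> with \<open>g\<close> real valued and put \<open>q = v / w\<close>.  Then the
  norm is at most \<open>c\<close> exactly when \<open>\<integral>\<bar>g\<bar> \<le> c\<close> and \<open>\<bar>g\<bar> q \<le> c\<close> almost
  everywhere on \<open>\<Gamma>\<close>.  The third condition says that \<open>\<Gamma>\<close> has full measure and
  \<open>\<integral>1 / q \<le> 1\<close>.

  If this condition holds, then \<open>\<bar>g\<bar> q \<le> c\<close> forces \<open>\<integral>\<bar>g\<bar> \<le> c\<close>, so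
  the first half of the norm never matters and the space is the weighted \<open>L\<^sub>\<infinity>\<close>.
  Conversely, if the two spaces and norms agree, testing on \<open>g = 1 / q\<close> gives
  \<open>\<integral>1 / q \<le> 1\<close>.  Then the restriction of \<open>1 / q\<close> to the complement of
  \<open>\<Gamma>\<close> has norm below one in the intersection, but norm one in \<open>L\<^sub>\<infinity>\<close>
  unless the complement is null.

  A weighted \<open>L\<^sub>\<infinity>\<close> over a non-atomic measure has the Daugavet property
  (\<open>Daugavet_estimate\<close>).  Let \<open>T g = \<phi>(g) y\<close> and let \<open>x\<close> be in the unit ball.  Cut a set
  on which \<open>\<bar>\<phi>(x) y\<bar> q\<close> nearly attains its supremum into many disjoint pieces of positive
  measure.  Changing \<open>x\<close> on one piece, to a function of modulus \<open>1 / q\<close> with the sign of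
  \<open>\<phi>(x) y\<close>, leaves it in the unit ball.  The changes for the various pieces are disjointly
  supported, so the changes of \<open>\<phi>\<close> have bounded absolute sum and one of them is small.  For
  that piece, \<open>x + T x\<close> has norm almost \<open>1 + \<bar>\<phi>(x)\<bar> \<parallel>y\<parallel>\<close>.

  If the condition fails, the function equal to \<open>1 / q\<close> on \<open>\<Gamma>\<close> and to \<open>\<infinity>\<close>
  elsewhere has integral above one.  Truncating and normalizing it gives \<open>y \<ge> 0\<close> with
  \<open>\<integral>y = 1\<close>, positive on \<open>\<Gamma>\<close>, whose weighted supremum norm \<open>s\<close> on \<open>\<Gamma>\<close> is below
  one (\<open>exists_flat_unit_function\<close>).  Let \<open>T g = - p(g) y\<close> with
  \<open>p(g) = \<integral>\<^sub>\<Gamma> g y q\<close>.  Subtracting \<open>p(g) y\<close> from \<open>g\<close> cancels mass: for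
  \<open>p(g) \<ge> 0\<close> the integral norm of the difference is at most \<open>1 + p(g) - 2 p(g)\<^sup>2\<close>.
  Its weighted supremum norm on \<open>\<Gamma>\<close> is at most \<open>1 + s p(g)\<close>, hence
  \<open>\<parallel>I + T\<parallel> < 1 + \<parallel>T\<parallel>\<close> (\<open>not_Daugavet\<close>).\<close>

section \<open>Classes of functions\<close>

lemma L0_class_eq_iff:
  assumes "f \<in> borel_measurable M" "g \<in> borel_measurable M"
  shows "L0_class M f = L0_class M g \<longleftrightarrow> (AE t in M. f t = g t)"
proof
  assume "L0_class M f = L0_class M g"
  moreover have "g \<in> L0_class M g"
    using assms by (auto simp: L0_class_def AE_rel_def)
  ultimately have "g \<in> L0_class M f" by simp
  then show "AE t in M. f t = g t"
    by (auto simp: L0_class_def AE_rel_def)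
next
  assume eq: "AE t in M. f t = g t"
  have "(AE t in M. f t = h t) \<longleftrightarrow> (AE t in M. g t = h t)" for h :: "'a \<Rightarrow> ereal"
  proof
    assume "AE t in M. f t = h t"
    with eq show "AE t in M. g t = h t" by eventually_elim simp
  next
    assume "AE t in M. g t = h t"
    with eq show "AE t in M. f t = h t" by eventually_elim simp
  qed
  then show "L0_class M f = L0_class M g"
    using assms by (auto simp: L0_class_def AE_rel_def)
qed

lemma mem_L0_class_iff:
  "g \<in> L0_class M f \<longleftrightarrow>
     f \<in> borel_measurable M \<and> g \<in> borel_measurable M \<and> (AE t in M. f t = g t)"
  by (auto simp: L0_class_def AE_rel_def)

lemma L0_lift_class:
  assumes "f \<in> borel_measurable M"
    and "\<And>g. g \<in> borel_measurable M \<Longrightarrow> AE t in M. f t = g t \<Longrightarrow> F g = F f"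
  shows "L0_lift F (L0_class M f) = F f"
proof -
  have "F ` L0_class M f = {F f}"
  proof
    show "F ` L0_class M f \<subseteq> {F f}"
      by (clarsimp simp: mem_L0_class_iff) (rule assms(2))
    have "f \<in> L0_class M f" using assms(1) by (simp add: mem_L0_class_iff)
    then show "{F f} \<subseteq> F ` L0_class M f" by blast
  qed
  then show ?thesis by (simp add: L0_lift_def)
qed

lemma L0_add_class:
  assumes [measurable]: "f \<in> borel_measurable M" "g \<in> borel_measurable M"
  shows "L0_add M (L0_class M f) (L0_class M g) = L0_class M (\<lambda>t. f t + g t)"
proof -
  have "L0_class M (\<lambda>t. f' t + g' t) = L0_class M (\<lambda>t. f t + g t)"
    if f': "f' \<in> L0_class M f" and g': "g' \<in> L0_class M g" for f' g'
  proof -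
    have [measurable]: "f' \<in> borel_measurable M" "g' \<in> borel_measurable M"
      using f' g' by (auto simp: mem_L0_class_iff)
    have "AE t in M. f t = f' t" "AE t in M. g t = g' t"
      using f' g' by (auto simp: mem_L0_class_iff)
    then have "AE t in M. f' t + g' t = f t + g t" by eventually_elim simp
    then show ?thesis by (subst L0_class_eq_iff) (auto intro!: borel_measurable_ereal_add)
  qed
  moreover have "f \<in> L0_class M f" "g \<in> L0_class M g"
    by (auto simp: mem_L0_class_iff)
  ultimately show ?thesis unfolding L0_add_def by blast
qed

lemma L0_scale_class:
  assumes [measurable]: "f \<in> borel_measurable M"
  shows "L0_scale M c (L0_class M f) = L0_class M (\<lambda>t. ereal c * f t)"
proof -
  have "L0_class M (\<lambda>t. ereal c * f' t) = L0_class M (\<lambda>t. ereal c * f t)"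
    if f': "f' \<in> L0_class M f" for f'
  proof -
    have [measurable]: "f' \<in> borel_measurable M"
      using f' by (auto simp: mem_L0_class_iff)
    have "AE t in M. f t = f' t"
      using f' by (auto simp: mem_L0_class_iff)
    then have "AE t in M. ereal c * f' t = ereal c * f t" by eventually_elim simp
    then show ?thesis by (subst L0_class_eq_iff) (auto intro!: borel_measurable_ereal_times)
  qed
  moreover have "f \<in> L0_class M f"
    by (auto simp: mem_L0_class_iff)
  ultimately show ?thesis unfolding L0_scale_def by blast
qed

lemma L1_norm_cong_AE:
  assumes "f \<in> borel_measurable M" "g \<in> borel_measurable M" "AE t in M. f t = g t"
  shows "L1_norm M S u f = L1_norm M S u g"
  unfolding L1_norm_def by (rule nn_integral_cong_AE) (use assms(3) in eventually_elim, simp)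

lemma measurable_Linf_integrand:
  assumes [measurable]: "u \<in> borel_measurable M" "f \<in> borel_measurable M"
  shows "(\<lambda>t. e2ennreal \<bar>f t * u t\<bar>) \<in> borel_measurable (restrict_space M S)"
proof (rule measurable_restrict_space1)
  have [measurable]: "(\<lambda>t. f t * u t) \<in> borel_measurable M"
    by (rule borel_measurable_ereal_times) auto
  show "(\<lambda>t. e2ennreal \<bar>f t * u t\<bar>) \<in> borel_measurable M" by measurable
qed

lemma Linf_norm_le_iff:
  assumes [measurable]: "u \<in> borel_measurable M" "f \<in> borel_measurable M" "S \<in> sets M"
  shows "Linf_norm M S u f \<le> c \<longleftrightarrow> (AE t in M. t \<in> S \<longrightarrow> e2ennreal \<bar>f t * u t\<bar> \<le> c)"
proof -
  have AE: "(AE t in restrict_space M S. P t) \<longleftrightarrow> (AE t in M. t \<in> S \<longrightarrow> P t)" for P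
    by (subst AE_restrict_space_iff) (use assms(3) in auto)
  show ?thesis
  proof
    assume le: "Linf_norm M S u f \<le> c"
    have "AE t in restrict_space M S. e2ennreal \<bar>f t * u t\<bar> \<le> Linf_norm M S u f"
      unfolding Linf_norm_def by (rule esssup_AE)
    then have "AE t in restrict_space M S. e2ennreal \<bar>f t * u t\<bar> \<le> c"
      by eventually_elim (use le in auto)
    then show "AE t in M. t \<in> S \<longrightarrow> e2ennreal \<bar>f t * u t\<bar> \<le> c" by (simp add: AE)
  next
    assume "AE t in M. t \<in> S \<longrightarrow> e2ennreal \<bar>f t * u t\<bar> \<le> c"
    then show "Linf_norm M S u f \<le> c"
      unfolding Linf_norm_def
      by (intro esssup_I measurable_Linf_integrand) (auto simp: AE)
  qed
qed

lemma Linf_norm_cong_AE: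
  assumes [measurable]: "u \<in> borel_measurable M" "f \<in> borel_measurable M" "g \<in> borel_measurable M"
      "S \<in> sets M"
    and eq: "AE t in M. t \<in> S \<longrightarrow> f t = g t"
  shows "Linf_norm M S u f = Linf_norm M S u g"
  unfolding Linf_norm_def
proof (intro esssup_AE_cong measurable_Linf_integrand assms(1-3))
  show "AE t in restrict_space M S. e2ennreal \<bar>f t * u t\<bar> = e2ennreal \<bar>g t * u t\<bar>"
    using eq by (subst AE_restrict_space_iff) (auto elim!: eventually_mono)
qed

lemma restr_measurable [measurable]:
  assumes [measurable]: "f \<in> borel_measurable M" "S \<in> sets M"
  shows "restr S f \<in> borel_measurable M"
  unfolding restr_def by (intro borel_measurable_ereal_times) auto

lemma Linf_norm_restr:
  assumes "u \<in> borel_measurable M" "f \<in> borel_measurable M" "S \<in> sets M"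
  shows "Linf_norm M S u (restr S f) = Linf_norm M S u f"
  by (intro Linf_norm_cong_AE) (use assms in \<open>auto simp: restr_def\<close>)

lemma L0_class_in_L1_set_iff:
  assumes "f \<in> borel_measurable M"
  shows "L0_class M f \<in> L1_set M S u \<longleftrightarrow>
     (AE t in M. t \<notin> S \<longrightarrow> f t = 0) \<and> L1_norm M S u f < \<infinity>"
proof
  assume "L0_class M f \<in> L1_set M S u"
  then obtain g where g: "g \<in> borel_measurable M" "L0_class M f = L0_class M g"
    "AE t in M. t \<notin> S \<longrightarrow> g t = 0" "L1_norm M S u g < \<infinity>"
    by (auto simp: L1_set_def)
  have eq: "AE t in M. f t = g t" using g assms by (simp add: L0_class_eq_iff)
  have "AE t in M. t \<notin> S \<longrightarrow> f t = 0"
    using eq g(3) by eventually_elim simp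
  then show "(AE t in M. t \<notin> S \<longrightarrow> f t = 0) \<and> L1_norm M S u f < \<infinity>"
    using L1_norm_cong_AE[OF assms g(1) eq] g(4) by simp
qed (use assms in \<open>auto simp: L1_set_def\<close>)

lemma L0_class_in_Linf_set_iff:
  assumes "f \<in> borel_measurable M" "u \<in> borel_measurable M" "S \<in> sets M"
  shows "L0_class M f \<in> Linf_set M S u \<longleftrightarrow>
     (AE t in M. t \<notin> S \<longrightarrow> f t = 0) \<and> Linf_norm M S u f < \<infinity>"
proof
  assume "L0_class M f \<in> Linf_set M S u"
  then obtain g where g: "g \<in> borel_measurable M" "L0_class M f = L0_class M g"
    "AE t in M. t \<notin> S \<longrightarrow> g t = 0" "Linf_norm M S u g < \<infinity>"
    by (auto simp: Linf_set_def)
  have eq: "AE t in M. f t = g t" using g assms by (simp add: L0_class_eq_iff)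
  then have "AE t in M. t \<in> S \<longrightarrow> f t = g t" by eventually_elim simp
  then have "Linf_norm M S u f < \<infinity>"
    using Linf_norm_cong_AE[of u M f g S] g(1,4) assms by simp
  moreover have "AE t in M. t \<notin> S \<longrightarrow> f t = 0"
    using eq g(3) by eventually_elim simp
  ultimately show "(AE t in M. t \<notin> S \<longrightarrow> f t = 0) \<and> Linf_norm M S u f < \<infinity>" by simp
qed (use assms in \<open>auto simp: Linf_set_def\<close>)

section \<open>Operator norms\<close>

text \<open>The supremum in \<open>operator_norm\<close> is one of reals and means nothing unless the values are
  bounded; the constant \<open>C\<close> guarantees this.\<close>
lemma operator_norm_upper:
  assumes "\<And>z. z \<in> vecs X \<Longrightarrow> vnorm X z \<le> 1 \<Longrightarrow> vnorm X (T z) \<le> C"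
    and "x \<in> vecs X" "vnorm X x \<le> 1"
  shows "vnorm X (T x) \<le> operator_norm X T"
  unfolding operator_norm_def
  by (rule cSUP_upper) (use assms in \<open>auto intro!: bdd_aboveI2\<close>)

lemma operator_norm_least:
  assumes "x \<in> vecs X" "vnorm X x \<le> 1"
    and "\<And>z. z \<in> vecs X \<Longrightarrow> vnorm X z \<le> 1 \<Longrightarrow> vnorm X (T z) \<le> C"
  shows "operator_norm X T \<le> C"
  unfolding operator_norm_def by (rule cSUP_least) (use assms in auto)

section \<open>Non-atomic measures\<close>

lemma non_atomic_disjoint_pieces:
  fixes N :: nat
  assumes na: "non_atomic M" and "D \<in> sets M" "emeasure M D > 0"
  shows "\<exists>A. disjoint_family_on A {..<N} \<and>
     (\<forall>i<N. A i \<in> sets M \<and> A i \<subseteq> D \<and> emeasure M (A i) > 0)"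
  using assms(2,3)
proof (induction N arbitrary: D)
  case 0
  then show ?case by (simp add: disjoint_family_on_def)
next
  case (Suc N)
  then have "\<not> atom M D" using na by (auto simp: non_atomic_def)
  then obtain B where B: "B \<in> sets M" "B \<subseteq> D" "emeasure M B > 0" "emeasure M (D - B) > 0"
    using Suc.prems by (auto simp: atom_def zero_less_iff_neq_zero)
  from Suc.IH[of "D - B"] B Suc.prems obtain A where A: "disjoint_family_on A {..<N}"
    "\<forall>i<N. A i \<in> sets M \<and> A i \<subseteq> D - B \<and> emeasure M (A i) > 0" by auto
  have "disjoint_family_on (A(N := B)) {..<Suc N}"
    unfolding disjoint_family_on_def
  proof (intro ballI impI)
    fix i j assume ij: "i \<in> {..<Suc N}" "j \<in> {..<Suc N}" "i \<noteq> j"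
    consider "i = N" "j < N" | "j = N" "i < N" | "i < N" "j < N" using ij by force
    then show "(A(N := B)) i \<inter> (A(N := B)) j = {}"
    proof cases
      case 1
      then have "A j \<subseteq> D - B" using A(2) by blast
      then show ?thesis using 1 by auto
    next
      case 2
      then have "A i \<subseteq> D - B" using A(2) by blast
      then show ?thesis using 2 by auto
    next
      case 3
      then show ?thesis using A(1) ij(3) by (simp add: disjoint_family_on_def)
    qed
  qed
  moreover have "\<forall>i<Suc N. (A(N := B)) i \<in> sets M \<and> (A(N := B)) i \<subseteq> D \<and>
      emeasure M ((A(N := B)) i) > 0"
    using A(2) B by (auto simp: less_Suc_eq)
  ultimately show ?case by blast
qed

section \<open>Functionals on a weighted space of bounded functions\<close>

definition weighted_ball :: "'a measure \<Rightarrow> ('a \<Rightarrow> real) \<Rightarrow> real \<Rightarrow> ('a \<Rightarrow> real) set" where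
  "weighted_ball M q c = {g \<in> borel_measurable M. AE t in M. \<bar>g t\<bar> * q t \<le> c}"

lemma weighted_ball_add:
  assumes "f \<in> weighted_ball M q c" "g \<in> weighted_ball M q d" and q: "\<And>t. q t > 0"
  shows "(\<lambda>t. f t + g t) \<in> weighted_ball M q (c + d)"
proof -
  have [measurable]: "f \<in> borel_measurable M" "g \<in> borel_measurable M"
    using assms by (auto simp: weighted_ball_def)
  have "AE t in M. \<bar>f t\<bar> * q t \<le> c" "AE t in M. \<bar>g t\<bar> * q t \<le> d"
    using assms by (auto simp: weighted_ball_def)
  then have "AE t in M. \<bar>f t + g t\<bar> * q t \<le> c + d"
  proof eventually_elim
    case (elim t)
    have "\<bar>f t + g t\<bar> * q t \<le> (\<bar>f t\<bar> + \<bar>g t\<bar>) * q t"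
      by (intro mult_right_mono) (use q[of t] in auto)
    then show ?case using elim by (simp add: distrib_right)
  qed
  then show ?thesis by (simp add: weighted_ball_def)
qed

lemma weighted_ball_scale:
  assumes "f \<in> weighted_ball M q c"
  shows "(\<lambda>t. a * f t) \<in> weighted_ball M q (\<bar>a\<bar> * c)"
proof -
  have [measurable]: "f \<in> borel_measurable M"
    using assms by (auto simp: weighted_ball_def)
  have "AE t in M. \<bar>f t\<bar> * q t \<le> c"
    using assms by (auto simp: weighted_ball_def)
  then have "AE t in M. \<bar>a * f t\<bar> * q t \<le> \<bar>a\<bar> * c"
    by eventually_elim (simp add: abs_mult mult.assoc mult_left_mono)
  then show ?thesis by (simp add: weighted_ball_def)
qed

text \<open>Choosing signs turns the sum into the value of \<open>\<phi>\<close> at one signed combination of the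
  \<open>d i\<close>.  Since at most one term is nonzero at each point, that combination stays in the same
  ball however many terms there are.\<close>
lemma sum_functional_disjoint_le:
  fixes \<phi> :: "('a \<Rightarrow> real) \<Rightarrow> real" and N :: nat
  assumes q: "\<And>t. q t > 0" and "0 \<le> c"
    and add: "\<And>f g a b. f \<in> weighted_ball M q a \<Longrightarrow> g \<in> weighted_ball M q b
        \<Longrightarrow> \<phi> (\<lambda>t. f t + g t) = \<phi> f + \<phi> g"
    and scale: "\<And>f a b. f \<in> weighted_ball M q b \<Longrightarrow> \<phi> (\<lambda>t. a * f t) = a * \<phi> f"
    and bound: "\<And>f. f \<in> weighted_ball M q c \<Longrightarrow> \<bar>\<phi> f\<bar> \<le> L"
    and d: "\<And>i. i < N \<Longrightarrow> d i \<in> weighted_ball M q c"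
    and supp: "\<And>i t. i < N \<Longrightarrow> t \<notin> A i \<Longrightarrow> d i t = 0"
    and disj: "disjoint_family_on A {..<N}"
  shows "(\<Sum>i<N. \<bar>\<phi> (d i)\<bar>) \<le> L"
proof -
  define F where "F n t = (\<Sum>i<n. sgn (\<phi> (d i)) * d i t)" for n t
  have F: "F n \<in> weighted_ball M q (\<Sum>i<n. \<bar>sgn (\<phi> (d i))\<bar> * c)
      \<and> \<phi> (F n) = (\<Sum>i<n. \<bar>\<phi> (d i)\<bar>)" if "n \<le> N" for n
    using that
  proof (induction n)
    case 0
    have F0: "F 0 = (\<lambda>t. 0)" by (auto simp: F_def)
    have "(\<lambda>t. 0) \<in> weighted_ball M q 0" by (simp add: weighted_ball_def)
    then show ?case using scale[of "\<lambda>t. 0" 0 0] by (simp add: F0)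
  next
    case (Suc n)
    define h where "h t = sgn (\<phi> (d n)) * d n t" for t
    have dn: "d n \<in> weighted_ball M q c" using d Suc.prems by simp
    have h: "h \<in> weighted_ball M q (\<bar>sgn (\<phi> (d n))\<bar> * c)"
      unfolding h_def by (rule weighted_ball_scale[OF dn])
    have "\<phi> h = \<bar>\<phi> (d n)\<bar>"
      unfolding h_def scale[OF dn] by (simp add: abs_sgn mult.commute)
    have "F (Suc n) = (\<lambda>t. F n t + h t)" by (auto simp: F_def h_def)
    moreover have Fn: "F n \<in> weighted_ball M q (\<Sum>i<n. \<bar>sgn (\<phi> (d i))\<bar> * c)"
        "\<phi> (F n) = (\<Sum>i<n. \<bar>\<phi> (d i)\<bar>)"
      using Suc by auto
    ultimately have "\<phi> (F (Suc n)) = (\<Sum>i<Suc n. \<bar>\<phi> (d i)\<bar>)"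
      using add[OF Fn(1) h] \<open>\<phi> h = _\<close> by simp
    moreover have "F (Suc n) \<in> weighted_ball M q (\<Sum>i<Suc n. \<bar>sgn (\<phi> (d i))\<bar> * c)"
      using weighted_ball_add[OF Fn(1) h q] \<open>F (Suc n) = _\<close> by simp
    ultimately show ?case by blast
  qed
  have "AE t in M. \<forall>i<N. \<bar>d i t\<bar> * q t \<le> c"
    using d by (auto simp: weighted_ball_def AE_all_countable)
  then have "AE t in M. \<bar>F N t\<bar> * q t \<le> c"
  proof eventually_elim
    case (elim t)
    show ?case
    proof (cases "\<exists>j<N. t \<in> A j")
      case True
      then obtain j where j: "j < N" "t \<in> A j" by blast
      have "d i t = 0" if "i < N" "i \<noteq> j" for i
        using disj j that supp[of i t] by (auto simp: disjoint_family_on_def)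
      then have "F N t = (\<Sum>i\<in>{j}. sgn (\<phi> (d i)) * d i t)"
        unfolding F_def by (intro sum.mono_neutral_right) (use j in auto)
      then have "\<bar>F N t\<bar> \<le> \<bar>d j t\<bar>" by (simp add: abs_mult abs_sgn_eq)
      then have "\<bar>F N t\<bar> * q t \<le> \<bar>d j t\<bar> * q t"
        by (intro mult_right_mono) (use q[of t] in auto)
      then show ?thesis using elim j by fastforce
    next
      case False
      then have "F N t = 0" unfolding F_def using supp by (intro sum.neutral) auto
      then show ?thesis using \<open>0 \<le> c\<close> by simp
    qed
  qed
  then have "F N \<in> weighted_ball M q c" using F[of N] by (simp add: weighted_ball_def)
  then show ?thesis using bound[of "F N"] F[of N] by simp
qed

text \<open>The conclusion for all \<open>x\<close> in the unit ball says \<open>\<parallel>T\<parallel> \<le> B - 1\<close> for the operator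
  \<open>T z = \<phi>(z) y\<close>, where \<open>B\<close> bounds \<open>\<parallel>I + T\<parallel>\<close>.  A violation would occur with a
  margin \<open>\<delta>\<close> on a set \<open>D\<close> of positive measure.  Replacing \<open>x\<close> on one of many pieces of
  \<open>D\<close> by \<open>\<sigma> / q\<close>, with \<open>\<sigma>\<close> the sign of \<open>\<phi>(x) y\<close>, makes the two summands of
  \<open>z + \<phi>(z) y\<close> add up there.\<close>
lemma Daugavet_estimate:
  fixes \<phi> :: "('a \<Rightarrow> real) \<Rightarrow> real"
  assumes na: "non_atomic M" and [measurable]: "q \<in> borel_measurable M" and q: "\<And>t. q t > 0"
    and add: "\<And>f g a b. f \<in> weighted_ball M q a \<Longrightarrow> g \<in> weighted_ball M q b
        \<Longrightarrow> \<phi> (\<lambda>t. f t + g t) = \<phi> f + \<phi> g"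
    and scale: "\<And>f a b. f \<in> weighted_ball M q b \<Longrightarrow> \<phi> (\<lambda>t. a * f t) = a * \<phi> f"
    and bound: "\<And>f. f \<in> weighted_ball M q 1 \<Longrightarrow> \<bar>\<phi> f\<bar> \<le> L"
    and y: "y \<in> weighted_ball M q Y"
    and upper: "\<And>z. z \<in> weighted_ball M q 1 \<Longrightarrow> AE t in M. \<bar>z t + \<phi> z * y t\<bar> * q t \<le> B"
    and x: "x \<in> weighted_ball M q 1"
  shows "AE t in M. \<bar>\<phi> x * y t\<bar> * q t \<le> B - 1"
proof (rule ccontr)
  assume not_le: "\<not> ?thesis"
  have [measurable]: "y \<in> borel_measurable M" "x \<in> borel_measurable M"
    using x y by (auto simp: weighted_ball_def)
  have xq: "AE t in M. \<bar>x t\<bar> * q t \<le> 1" and yq: "AE t in M. \<bar>y t\<bar> * q t \<le> Y"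
    using x y by (auto simp: weighted_ball_def)
  have "\<exists>n. \<not> (AE t in M. \<bar>\<phi> x * y t\<bar> * q t < B - 1 + 1 / Suc n)"
  proof (rule ccontr)
    assume "\<not> ?thesis"
    then have "AE t in M. \<forall>n::nat. \<bar>\<phi> x * y t\<bar> * q t < B - 1 + 1 / Suc n"
      by (simp add: AE_all_countable)
    then have "AE t in M. \<bar>\<phi> x * y t\<bar> * q t \<le> B - 1"
    proof eventually_elim
      case (elim t)
      show ?case
      proof (rule ccontr)
        assume "\<not> ?thesis"
        then obtain n where "inverse (real (Suc n)) < \<bar>\<phi> x * y t\<bar> * q t - (B - 1)"
          using reals_Archimedean[of "\<bar>\<phi> x * y t\<bar> * q t - (B - 1)"] by auto
        then show False using elim[rule_format, of n] by (simp add: inverse_eq_divide)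
      qed
    qed
    then show False using not_le by simp
  qed
  then obtain \<delta> where \<delta>: "\<delta> > 0" "\<not> (AE t in M. \<bar>\<phi> x * y t\<bar> * q t < B - 1 + \<delta>)"
    by (metis of_nat_0_less_iff zero_less_Suc zero_less_divide_1_iff)
  define D where "D = {t \<in> space M. B - 1 + \<delta> \<le> \<bar>\<phi> x * y t\<bar> * q t}"
  have [measurable]: "D \<in> sets M" unfolding D_def by measurable
  have "emeasure M D > 0"
  proof (rule ccontr)
    assume "\<not> ?thesis"
    then have "AE t in M. t \<notin> D" by (intro AE_not_in null_setsI) auto
    then have "AE t in M. \<bar>\<phi> x * y t\<bar> * q t < B - 1 + \<delta>"
      using AE_space by eventually_elim (auto simp: D_def)
    then show False using \<delta> by simp
  qed
  have "L \<ge> 0" using bound[of "\<lambda>t. 0"] by (auto simp: weighted_ball_def)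
  \<comment> \<open>The number of pieces makes the average change of \<open>\<phi>\<close> cost less than \<open>\<delta>\<close>.\<close>
  obtain N :: nat where N: "2 * L * (\<bar>Y\<bar> + 1) / \<delta> < real N"
    using reals_Archimedean2 by blast
  have "0 \<le> 2 * L * (\<bar>Y\<bar> + 1) / \<delta>" using \<open>L \<ge> 0\<close> \<delta> by simp
  then have "N > 0" using N by linarith
  obtain A where disj: "disjoint_family_on A {..<N}"
    and A: "\<And>i. i < N \<Longrightarrow> A i \<in> sets M \<and> A i \<subseteq> D \<and> emeasure M (A i) > 0"
    using non_atomic_disjoint_pieces[OF na \<open>D \<in> sets M\<close> \<open>emeasure M D > 0\<close>, of N] by blast
  \<comment> \<open>Modulus one is needed also where \<open>\<phi>(x) y\<close> vanishes, so this is not \<open>sgn\<close>.\<close>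
  define \<sigma> where "\<sigma> t = (if 0 \<le> \<phi> x * y t then 1 else - 1 :: real)" for t
  define d where "d i t = indicator (A i) t * (\<sigma> t / q t - x t)" for i t
  have \<sigma>[measurable]: "\<sigma> \<in> borel_measurable M" unfolding \<sigma>_def by measurable
  have \<sigma>_abs: "\<bar>\<sigma> t\<bar> = 1" for t by (simp add: \<sigma>_def)
  have \<sigma>q: "\<bar>\<sigma> t / q t\<bar> * q t = 1" for t using q[of t] by (simp add: \<sigma>_abs abs_divide)
  have dmeas: "d i \<in> borel_measurable M" if "i < N" for i
  proof -
    have [measurable]: "A i \<in> sets M" using A that by simp
    show ?thesis unfolding d_def by measurable
  qed
  have d: "d i \<in> weighted_ball M q 2" if "i < N" for i
  proof -
    have "AE t in M. \<bar>d i t\<bar> * q t \<le> 2"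
      using xq
    proof eventually_elim
      case (elim t)
      have "\<bar>d i t\<bar> * q t \<le> (\<bar>\<sigma> t / q t\<bar> + \<bar>x t\<bar>) * q t"
        using q[of t] abs_triangle_ineq4[of "\<sigma> t / q t" "x t"]
        by (intro mult_right_mono) (auto simp: d_def indicator_def)
      then show ?case using elim \<sigma>q[of t] unfolding distrib_right by linarith
    qed
    then show ?thesis using dmeas[OF that] by (simp add: weighted_ball_def)
  qed
  have bound2: "\<bar>\<phi> f\<bar> \<le> 2 * L" if f: "f \<in> weighted_ball M q 2" for f
    using weighted_ball_scale[OF f, of "1/2"] bound[of "\<lambda>t. 1/2 * f t"] scale[OF f, of "1/2"]
    by (simp add: abs_mult)
  have sum_le: "(\<Sum>i<N. \<bar>\<phi> (d i)\<bar>) \<le> 2 * L"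
  proof (rule sum_functional_disjoint_le[where q = q and M = M and c = 2 and A = A
        and \<phi> = \<phi> and d = d])
    show "d i t = 0" if "t \<notin> A i" for i t using that by (simp add: d_def)
  qed (fact q add scale bound2 d disj | simp)+
  have "\<exists>i<N. \<bar>\<phi> (d i)\<bar> \<le> 2 * L / N"
  proof (rule ccontr)
    assume "\<not> ?thesis"
    then have "(\<Sum>i<N. 2 * L / N) < (\<Sum>i<N. \<bar>\<phi> (d i)\<bar>)"
      by (intro sum_strict_mono) (use \<open>N > 0\<close> in auto)
    then show False using sum_le \<open>N > 0\<close> by simp
  qed
  then obtain i where i: "i < N" "\<bar>\<phi> (d i)\<bar> \<le> 2 * L / N" by blast
  define z where "z t = x t + d i t" for t
  have "AE t in M. \<bar>z t\<bar> * q t \<le> 1"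
    using xq by eventually_elim (use \<sigma>q in \<open>auto simp: z_def d_def indicator_def\<close>)
  then have z: "z \<in> weighted_ball M q 1"
    using dmeas[OF i(1)] by (simp add: weighted_ball_def z_def[abs_def])
  have \<phi>z: "\<phi> z = \<phi> x + \<phi> (d i)"
    unfolding z_def by (rule add[OF x d[OF i(1)]])
  have "AE t in M. t \<notin> A i"
    using upper[OF z] yq
  proof eventually_elim
    case (elim t)
    show ?case
    proof
      assume t: "t \<in> A i"
      then have "B - 1 + \<delta> \<le> \<bar>\<phi> x * y t\<bar> * q t" using A[OF i(1)] by (auto simp: D_def)
      moreover have zt: "z t * q t = \<sigma> t" using t q[of t] by (simp add: z_def d_def)
      have eq: "(z t + \<phi> z * y t) * q t = \<sigma> t + \<phi> x * y t * q t + \<phi> (d i) * (y t * q t)"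
        by (simp add: distrib_right zt[symmetric] \<phi>z algebra_simps)
      have "\<bar>\<sigma> t + \<phi> x * y t * q t\<bar> = 1 + \<bar>\<phi> x * y t\<bar> * q t"
      proof (cases "0 \<le> \<phi> x * y t")
        case True
        then have "0 \<le> \<phi> x * y t * q t" using q[of t] by (rule mult_nonneg_nonneg[OF _ less_imp_le])
        then show ?thesis using True by (simp add: \<sigma>_def)
      next
        case False
        then have "\<phi> x * y t * q t \<le> 0" using q[of t] by (auto intro: mult_nonpos_nonneg)
        then show ?thesis using False by (simp add: \<sigma>_def)
      qed
      moreover have "\<bar>\<phi> (d i) * (y t * q t)\<bar> \<le> 2 * L / N * (\<bar>Y\<bar> + 1)"
        unfolding abs_mult using i(2) elim(2) q[of t] by (intro mult_mono) auto
      moreover have "2 * L / N * (\<bar>Y\<bar> + 1) < \<delta>"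
        using N \<open>N > 0\<close> \<delta>(1) by (simp add: field_simps)
      moreover have "\<bar>(z t + \<phi> z * y t) * q t\<bar> \<le> B"
        using elim(1) q[of t] by (simp add: abs_mult)
      ultimately show False unfolding eq by linarith
    qed
  qed
  then have "emeasure M (A i) = 0"
    using A[OF i(1)] by (subst (asm) AE_iff_measurable[OF _ refl]) (auto dest: sets.sets_into_space
      simp: Collect_conj_eq Int_absorb1)
  then show False using A[OF i(1)] by simp
qed

section \<open>An operator of small perturbation norm\<close>

text \<open>On \<open>S\<close> both \<open>a = \<bar>g\<bar> q\<close> and \<open>b = p y q\<close> lie between zero and one.  Where
  \<open>g \<ge> 0\<close>, \<open>\<bar>a - b\<bar> = a + b - 2 min a b \<le> a + b - 2 a b\<close>, which after division by
  \<open>q\<close> and integration saves twice \<open>p \<integral>\<^sub>S g y q = p\<^sup>2\<close>.  Where \<open>g < 0\<close> the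
  same bound holds because the correction has the favourable sign.\<close>
lemma subtract_functional_multiple_estimate:
  fixes g y q :: "'a \<Rightarrow> real"
  assumes [measurable]: "S \<in> sets M" "q \<in> borel_measurable M" and q: "\<And>t. q t > 0"
    and g: "integrable M g" "(\<integral>t. \<bar>g t\<bar> \<partial>M) \<le> 1" "AE t in M. t \<in> S \<longrightarrow> \<bar>g t\<bar> * q t \<le> 1"
    and y: "integrable M y" "\<And>t. 0 \<le> y t" "(\<integral>t. y t \<partial>M) = 1"
      "AE t in M. t \<in> S \<longrightarrow> y t * q t \<le> s" and s: "s \<le> 1"
    and int: "integrable M (\<lambda>t. indicator S t * (g t * y t * q t))"
    and p: "p = (\<integral>t. indicator S t * (g t * y t * q t) \<partial>M)" "0 \<le> p" "p \<le> 1"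
  shows "(\<integral>t. \<bar>g t - p * y t\<bar> \<partial>M) \<le> 1 + p - 2 * p\<^sup>2"
    and "AE t in M. t \<in> S \<longrightarrow> \<bar>g t - p * y t\<bar> * q t \<le> 1 + p * s"
proof -
  have "(\<integral>t. \<bar>g t - p * y t\<bar> \<partial>M)
      \<le> (\<integral>t. \<bar>g t\<bar> + p * y t - 2 * p * (indicator S t * (g t * y t * q t)) \<partial>M)"
  proof (rule integral_mono_AE)
    show "AE t in M. \<bar>g t - p * y t\<bar>
        \<le> \<bar>g t\<bar> + p * y t - 2 * p * (indicator S t * (g t * y t * q t))"
      using g(3) y(4)
    proof eventually_elim
      case (elim t)
      have py: "0 \<le> p * y t" using p y by simp
      show ?case
      proof (cases "t \<in> S")
        case True
        have gq: "\<bar>g t\<bar> * q t \<le> 1" and "y t * q t \<le> 1" using elim True s by auto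
        then have "p * (y t * q t) \<le> 1 * 1" using p y(2)[of t] q[of t]
          by (intro mult_mono) auto
        then have pyq: "p * y t * q t \<le> 1" by (simp add: mult.assoc)
        show ?thesis
        proof (cases "0 \<le> g t")
          case g0: True
          have 1: "g t * (p * y t * q t) \<le> g t * 1" by (rule mult_left_mono[OF pyq g0])
          have 2: "(p * y t) * (g t * q t) \<le> (p * y t) * 1"
            by (rule mult_left_mono[OF _ py]) (use gq g0 in simp)
          from 1 2 show ?thesis using True g0 by (simp add: algebra_simps abs_if)
        next
          case False
          have "0 \<le> (- g t) * (p * y t) * q t"
            by (rule mult_nonneg_nonneg[OF mult_nonneg_nonneg[OF _ py]])
              (use False q[of t] in auto)
          then show ?thesis using True False py by (simp add: algebra_simps abs_if)
        qed
      next
        case False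
        then show ?thesis using py by (simp add: abs_if)
      qed
    qed
  qed (use g y int in auto)
  also have "\<dots> = (\<integral>t. \<bar>g t\<bar> \<partial>M) + p * (\<integral>t. y t \<partial>M) - 2 * p * p"
    using g(1) y(1) int by (simp add: p(1))
  also have "\<dots> \<le> 1 + p - 2 * p\<^sup>2" using g y by (simp add: power2_eq_square)
  finally show "(\<integral>t. \<bar>g t - p * y t\<bar> \<partial>M) \<le> 1 + p - 2 * p\<^sup>2" .
  show "AE t in M. t \<in> S \<longrightarrow> \<bar>g t - p * y t\<bar> * q t \<le> 1 + p * s"
    using g(3) y(4)
  proof eventually_elim
    case (elim t)
    have "\<bar>g t - p * y t\<bar> * q t \<le> (\<bar>g t\<bar> + p * y t) * q t"
      using mult_nonneg_nonneg[OF p(2) y(2)[of t]] q[of t]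
      by (intro mult_right_mono) (auto simp: abs_if)
    moreover have "p * (y t * q t) \<le> p * s" if "t \<in> S"
      using elim that p by (intro mult_left_mono) auto
    ultimately show ?case using elim by (auto simp: algebra_simps)
  qed
qed

text \<open>The common right-hand side is below \<open>1 + P\<close> if \<open>s < 1\<close>.  The gain \<open>2 p\<^sup>2\<close> is
  useless for small \<open>p\<close>, but then \<open>1 + p\<close> is itself well below \<open>1 + P\<close>; the two cases are
  split at \<open>P / 2\<close>.\<close>
lemma perturbation_gap:
  fixes p P s :: real
  assumes "0 < P" "0 \<le> p" "p \<le> P" "0 \<le> s"
  shows "1 + p * s \<le> 1 + max (P * s) (max (P / 2) (P - P\<^sup>2 / 2))"
    and "1 + p - 2 * p\<^sup>2 \<le> 1 + max (P * s) (max (P / 2) (P - P\<^sup>2 / 2))"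
proof -
  have "p * s \<le> P * s" using assms by (intro mult_right_mono) auto
  then show "1 + p * s \<le> 1 + max (P * s) (max (P / 2) (P - P\<^sup>2 / 2))" by simp
  show "1 + p - 2 * p\<^sup>2 \<le> 1 + max (P * s) (max (P / 2) (P - P\<^sup>2 / 2))"
  proof (cases "p \<le> P / 2")
    case True
    have "0 \<le> p\<^sup>2" by simp
    with True have "1 + p - 2 * p\<^sup>2 \<le> 1 + P / 2" by linarith
    then show ?thesis by simp
  next
    case False
    then have "(P / 2)\<^sup>2 \<le> p\<^sup>2" using assms by (intro power_mono) auto
    then have "1 + p - 2 * p\<^sup>2 \<le> 1 + (P - P\<^sup>2 / 2)" using assms by (simp add: power2_eq_square)
    then show ?thesis by linarith
  qed
qed

section \<open>Real coordinates for the weighted spaces\<close>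

text \<open>The value one where \<open>u\<close> is not a positive real keeps the function positive everywhere, so
  that division by it needs no exceptional set.\<close>
definition real_weight :: "('a \<Rightarrow> ereal) \<Rightarrow> 'a \<Rightarrow> real" where
  "real_weight u t = (if 0 < u t \<and> u t < \<infinity> then real_of_ereal (u t) else 1)"

lemma real_weight_pos: "real_weight u t > 0"
  by (cases "u t") (auto simp: real_weight_def)

lemma real_weight_measurable [measurable]:
  assumes [measurable]: "u \<in> borel_measurable M"
  shows "real_weight u \<in> borel_measurable M"
  unfolding real_weight_def[abs_def] by measurable

lemma real_weight_eq_AE:
  assumes "weight_on M S u"
  shows "AE t in M. t \<in> S \<longrightarrow> u t = ereal (real_weight u t)"
proof -
  have "AE t in M. t \<in> S \<longrightarrow> 0 < u t \<and> u t < \<infinity>"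
    using assms by (simp add: weight_on_def)
  then show ?thesis
  proof eventually_elim
    case (elim t)
    then show ?case by (cases "u t") (auto simp: real_weight_def)
  qed
qed

lemma enn2real_le_iff_le_ennreal:
  assumes "x < \<infinity>" "0 \<le> c"
  shows "enn2real x \<le> c \<longleftrightarrow> x \<le> ennreal c"
  using assms enn2real_le enn2real_leI by (metis infinity_ennreal_def less_irrefl)

locale weighted_intersection = sigma_finite_measure M for M :: "'a measure" +
  fixes \<Gamma> :: "'a set" and v w :: "'a \<Rightarrow> ereal"
  assumes \<Gamma> [measurable]: "\<Gamma> \<in> sets M"
    and v: "weight_on M \<Gamma> v"
    and w: "weight_on M (space M) w"
begin

lemma v_measurable [measurable]: "v \<in> borel_measurable M"
  using v by (simp add: weight_on_def)

lemma w_measurable [measurable]: "w \<in> borel_measurable M"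
  using w by (simp add: weight_on_def)

abbreviation "X \<equiv> L1_inter_Linf M \<Gamma> w v"
abbreviation "Y \<equiv> Linf_space M (space M) v"

definition q :: "'a \<Rightarrow> real" where
  "q t = real_weight v t / real_weight w t"

lemma q_pos: "q t > 0"
  by (simp add: q_def real_weight_pos)

lemma q_measurable [measurable]: "q \<in> borel_measurable M"
  unfolding q_def[abs_def] by measurable

definition repr :: "('a \<Rightarrow> real) \<Rightarrow> 'a \<Rightarrow> ereal" where
  "repr g = (\<lambda>t. ereal (g t / real_weight w t))"

definition cls :: "('a \<Rightarrow> real) \<Rightarrow> ('a \<Rightarrow> ereal) set" where
  "cls g = L0_class M (repr g)"

lemma repr_measurable [measurable]:
  "g \<in> borel_measurable M \<Longrightarrow> repr g \<in> borel_measurable M"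
  unfolding repr_def
  by (intro borel_measurable_ereal borel_measurable_divide real_weight_measurable w_measurable)

lemma cls_eq_iff:
  assumes "f \<in> borel_measurable M" "g \<in> borel_measurable M"
  shows "cls f = cls g \<longleftrightarrow> (AE t in M. f t = g t)"
proof -
  have "repr f t = repr g t \<longleftrightarrow> f t = g t" for t
    using real_weight_pos[of w t] by (simp add: repr_def)
  then show ?thesis
    unfolding cls_def by (subst L0_class_eq_iff) (use assms in auto)
qed

lemma L0_add_cls:
  assumes "f \<in> borel_measurable M" "g \<in> borel_measurable M"
  shows "L0_add M (cls f) (cls g) = cls (\<lambda>t. f t + g t)"
  unfolding cls_def using assms
  by (subst L0_add_class) (auto simp: repr_def add_divide_distrib)

lemma L0_scale_cls:
  assumes "f \<in> borel_measurable M"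
  shows "L0_scale M c (cls f) = cls (\<lambda>t. c * f t)"
  unfolding cls_def using assms by (subst L0_scale_class) (auto simp: repr_def)

lemma L1_norm_repr: "L1_norm M (space M) w (repr g) = (\<integral>\<^sup>+ t. ennreal \<bar>g t\<bar> \<partial>M)"
  unfolding L1_norm_def
proof (rule nn_integral_cong_AE)
  show "AE t in M. e2ennreal \<bar>repr g t * w t\<bar> * indicator (space M) t = ennreal \<bar>g t\<bar>"
    using real_weight_eq_AE[OF w] AE_space
  proof eventually_elim
    case (elim t)
    then have "repr g t * w t = ereal (g t)"
      using real_weight_pos[of w t] by (simp add: repr_def)
    then show ?case using elim by simp
  qed
qed

lemma Linf_norm_repr_le_iff:
  assumes S: "S \<in> sets M" "weight_on M S v" and [measurable]: "g \<in> borel_measurable M"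
    and "0 \<le> c"
  shows "Linf_norm M S v (repr g) \<le> ennreal c \<longleftrightarrow> (AE t in M. t \<in> S \<longrightarrow> \<bar>g t\<bar> * q t \<le> c)"
proof -
  have eq: "AE t in M. (t \<in> S \<longrightarrow> e2ennreal \<bar>repr g t * v t\<bar> \<le> ennreal c) \<longleftrightarrow>
      (t \<in> S \<longrightarrow> \<bar>g t\<bar> * q t \<le> c)"
    using real_weight_eq_AE[OF S(2)]
  proof eventually_elim
    case (elim t)
    have "e2ennreal \<bar>repr g t * v t\<bar> = ennreal (\<bar>g t\<bar> * q t)" if "t \<in> S"
    proof -
      have "repr g t * v t = ereal (g t * q t)"
        using elim that by (simp add: repr_def q_def)
      then show ?thesis using q_pos[of t] by (simp add: abs_mult)
    qed
    then show ?case using \<open>0 \<le> c\<close> by (auto simp: ennreal_le_iff)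
  qed
  have "Linf_norm M S v (repr g) \<le> ennreal c \<longleftrightarrow>
      (AE t in M. t \<in> S \<longrightarrow> e2ennreal \<bar>repr g t * v t\<bar> \<le> ennreal c)"
    by (rule Linf_norm_le_iff) (use S in auto)
  also have "\<dots> \<longleftrightarrow> (AE t in M. t \<in> S \<longrightarrow> \<bar>g t\<bar> * q t \<le> c)"
    by (rule eventually_cong[OF eq]) simp
  finally show ?thesis .
qed

lemma Linf_norm_repr_finite_iff:
  assumes S: "S \<in> sets M" "weight_on M S v" and g: "g \<in> borel_measurable M"
  shows "Linf_norm M S v (repr g) < \<infinity> \<longleftrightarrow> (\<exists>c. AE t in M. t \<in> S \<longrightarrow> \<bar>g t\<bar> * q t \<le> c)"
proof
  assume "Linf_norm M S v (repr g) < \<infinity>"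
  then have "Linf_norm M S v (repr g) \<le> ennreal (enn2real (Linf_norm M S v (repr g)))"
    by simp
  then show "\<exists>c. AE t in M. t \<in> S \<longrightarrow> \<bar>g t\<bar> * q t \<le> c"
    using Linf_norm_repr_le_iff[OF S g] by (meson enn2real_nonneg)
next
  assume "\<exists>c. AE t in M. t \<in> S \<longrightarrow> \<bar>g t\<bar> * q t \<le> c"
  then obtain c where "AE t in M. t \<in> S \<longrightarrow> \<bar>g t\<bar> * q t \<le> c" by blast
  then have "AE t in M. t \<in> S \<longrightarrow> \<bar>g t\<bar> * q t \<le> max c 0" by eventually_elim auto
  then have "Linf_norm M S v (repr g) \<le> ennreal (max c 0)"
    using Linf_norm_repr_le_iff[OF S g] by simp
  then show "Linf_norm M S v (repr g) < \<infinity>" using le_less_trans by fastforce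
qed

lemma L0_class_eq_cls:
  assumes [measurable]: "f \<in> borel_measurable M" and fin: "AE t in M. \<bar>f t\<bar> \<noteq> \<infinity>"
  obtains g where "g \<in> borel_measurable M" "L0_class M f = cls g"
proof -
  define g where "g t = real_of_ereal (f t) * real_weight w t" for t
  have [measurable]: "g \<in> borel_measurable M" unfolding g_def by measurable
  have "AE t in M. f t = repr g t"
    using fin
  proof eventually_elim
    case (elim t)
    then show ?case using real_weight_pos[of w t] by (auto simp: g_def repr_def ereal_real)
  qed
  then show thesis
    using that[of g] by (simp add: cls_def L0_class_eq_iff)
qed

definition coords :: "('a \<Rightarrow> real) set" where
  "coords = {g. integrable M g \<and> (\<exists>c. AE t in M. t \<in> \<Gamma> \<longrightarrow> \<bar>g t\<bar> * q t \<le> c)}"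

lemma coords_measurable: "g \<in> coords \<Longrightarrow> g \<in> borel_measurable M"
  by (auto simp: coords_def)

lemma L0_class_in_X_iff:
  assumes "f \<in> borel_measurable M"
  shows "L0_class M f \<in> vecs X \<longleftrightarrow>
    L1_norm M (space M) w f < \<infinity> \<and> Linf_norm M \<Gamma> v f < \<infinity>"
proof -
  have *: "L0_class M g \<in> L1_set M (space M) w \<and> L0_class M (restr \<Gamma> g) \<in> Linf_set M \<Gamma> v \<longleftrightarrow>
      L1_norm M (space M) w g < \<infinity> \<and> Linf_norm M \<Gamma> v g < \<infinity>" if "g \<in> borel_measurable M" for g
    using that by (simp add: L0_class_in_L1_set_iff L0_class_in_Linf_set_iff Linf_norm_restr)
      (auto simp: restr_def)
  show ?thesis
  proof
    assume "L0_class M f \<in> vecs X"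
    then obtain g where g: "g \<in> borel_measurable M" "L0_class M f = L0_class M g"
      "L1_norm M (space M) w g < \<infinity>" "Linf_norm M \<Gamma> v g < \<infinity>"
      using * by (auto simp: L1_inter_Linf_def)
    have eq: "AE t in M. f t = g t" using g(1,2) assms by (simp add: L0_class_eq_iff)
    have "AE t in M. t \<in> \<Gamma> \<longrightarrow> f t = g t" using eq by eventually_elim simp
    then show "L1_norm M (space M) w f < \<infinity> \<and> Linf_norm M \<Gamma> v f < \<infinity>"
      using g(3,4) L1_norm_cong_AE[OF assms g(1) eq]
        Linf_norm_cong_AE[OF v_measurable assms g(1) \<Gamma>] by simp
  next
    assume "L1_norm M (space M) w f < \<infinity> \<and> Linf_norm M \<Gamma> v f < \<infinity>"
    then show "L0_class M f \<in> vecs X"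
      using *[OF assms] assms by (auto simp: L1_inter_Linf_def)
  qed
qed

lemma cls_in_X_iff:
  assumes "g \<in> borel_measurable M"
  shows "cls g \<in> vecs X \<longleftrightarrow> g \<in> coords"
  unfolding cls_def using assms Linf_norm_repr_finite_iff[OF \<Gamma> v assms]
  by (auto simp: L0_class_in_X_iff L1_norm_repr coords_def integrable_iff_bounded)

text \<open>An element of the space is finite almost everywhere because its product with the positive
  weight \<open>w\<close> is integrable; this is what makes real coordinates available.\<close>
lemma vecs_X: "vecs X = cls ` coords"
proof
  show "cls ` coords \<subseteq> vecs X" using cls_in_X_iff coords_measurable by blast
  show "vecs X \<subseteq> cls ` coords"
  proof
    fix x assume x: "x \<in> vecs X"
    then obtain f where f: "f \<in> borel_measurable M" "x = L0_class M f"
      by (auto simp: L1_inter_Linf_def)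
    have [measurable]: "f \<in> borel_measurable M" by (fact f)
    have [measurable]: "(\<lambda>t. f t * w t) \<in> borel_measurable M"
      by (rule borel_measurable_ereal_times) auto
    have fin: "L1_norm M (space M) w f < \<infinity>" using x f L0_class_in_X_iff by auto
    have "AE t in M. e2ennreal \<bar>f t * w t\<bar> * indicator (space M) t \<noteq> \<infinity>"
      by (rule nn_integral_PInf_AE) (use fin in \<open>auto simp: L1_norm_def\<close>)
    then have "AE t in M. \<bar>f t\<bar> \<noteq> \<infinity>"
      using real_weight_eq_AE[OF w] AE_space
    proof eventually_elim
      case (elim t)
      then show ?case using real_weight_pos[of w t]
        by (cases "f t") auto
    qed
    then obtain g where "g \<in> borel_measurable M" "L0_class M f = cls g"
      using L0_class_eq_cls[OF f(1)] by blast
    then show "x \<in> cls ` coords" using x f cls_in_X_iff by auto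
  qed
qed

lemma norm_X_cls:
  assumes g: "g \<in> borel_measurable M"
  shows "vnorm X (cls g) = max (enn2real (\<integral>\<^sup>+ t. ennreal \<bar>g t\<bar> \<partial>M)) (enn2real (Linf_norm M \<Gamma> v (repr g)))"
proof -
  let ?F = "\<lambda>f. max (enn2real (L1_norm M (space M) w f)) (enn2real (Linf_norm M \<Gamma> v (restr \<Gamma> f)))"
  have "vnorm X (cls g) = L0_lift ?F (L0_class M (repr g))"
    by (simp add: L1_inter_Linf_def cls_def)
  also have "\<dots> = ?F (repr g)"
  proof (rule L0_lift_class)
    show "repr g \<in> borel_measurable M" using g by measurable
    fix h assume h: "h \<in> borel_measurable M" "AE t in M. repr g t = h t"
    have "AE t in M. t \<in> \<Gamma> \<longrightarrow> repr g t = h t" using h(2) by eventually_elim simp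
    then show "?F h = ?F (repr g)"
      using L1_norm_cong_AE[OF repr_measurable[OF g] h]
        Linf_norm_cong_AE[OF v_measurable repr_measurable[OF g] h(1) \<Gamma>] h(1) g
      by (simp add: Linf_norm_restr)
  qed
  also have "\<dots> = max (enn2real (\<integral>\<^sup>+ t. ennreal \<bar>g t\<bar> \<partial>M)) (enn2real (Linf_norm M \<Gamma> v (repr g)))"
    using g by (simp add: Linf_norm_restr L1_norm_repr)
  finally show ?thesis .
qed

text \<open>All later estimates of the norm go through this description of its balls.\<close>
lemma norm_X_le_iff:
  assumes g: "g \<in> coords" and "0 \<le> c"
  shows "vnorm X (cls g) \<le> c \<longleftrightarrow>
    (\<integral>t. \<bar>g t\<bar> \<partial>M) \<le> c \<and> (AE t in M. t \<in> \<Gamma> \<longrightarrow> \<bar>g t\<bar> * q t \<le> c)"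
proof -
  have "(\<integral>\<^sup>+ t. ennreal \<bar>g t\<bar> \<partial>M) = ennreal (\<integral>t. \<bar>g t\<bar> \<partial>M)"
    using g by (intro nn_integral_eq_integral) (auto simp: coords_def)
  moreover have "enn2real (Linf_norm M \<Gamma> v (repr g)) \<le> c \<longleftrightarrow>
      (AE t in M. t \<in> \<Gamma> \<longrightarrow> \<bar>g t\<bar> * q t \<le> c)"
  proof (subst enn2real_le_iff_le_ennreal)
    show "Linf_norm M \<Gamma> v (repr g) < \<infinity>"
      using g Linf_norm_repr_finite_iff[OF \<Gamma> v coords_measurable[OF g]] by (simp add: coords_def)
  qed (use Linf_norm_repr_le_iff[OF \<Gamma> v coords_measurable[OF g]] assms in auto)
  ultimately show ?thesis
    using norm_X_cls[OF coords_measurable[OF g]] by simp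
qed

lemma norm_X_nonneg: "g \<in> coords \<Longrightarrow> 0 \<le> vnorm X (cls g)"
  by (simp add: norm_X_cls coords_measurable max_def)

lemma norm_X_bounds:
  assumes "g \<in> coords"
  shows "(\<integral>t. \<bar>g t\<bar> \<partial>M) \<le> vnorm X (cls g)"
    and "AE t in M. t \<in> \<Gamma> \<longrightarrow> \<bar>g t\<bar> * q t \<le> vnorm X (cls g)"
  using norm_X_le_iff[OF assms norm_X_nonneg[OF assms]] by auto

lemma coords_add:
  assumes f: "f \<in> coords" and g: "g \<in> coords"
  shows "(\<lambda>t. f t + g t) \<in> coords"
    and "vnorm X (cls (\<lambda>t. f t + g t)) \<le> vnorm X (cls f) + vnorm X (cls g)"
proof -
  let ?c = "vnorm X (cls f) + vnorm X (cls g)"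
  have int: "integrable M f" "integrable M g" using f g by (auto simp: coords_def)
  have AE: "AE t in M. t \<in> \<Gamma> \<longrightarrow> \<bar>f t + g t\<bar> * q t \<le> ?c"
    using norm_X_bounds(2)[OF f] norm_X_bounds(2)[OF g]
  proof eventually_elim
    case (elim t)
    have "\<bar>f t + g t\<bar> * q t \<le> (\<bar>f t\<bar> + \<bar>g t\<bar>) * q t"
      by (intro mult_right_mono) (use q_pos[of t] in auto)
    then show ?case using elim unfolding distrib_right by auto
  qed
  then show *: "(\<lambda>t. f t + g t) \<in> coords" using int by (auto simp: coords_def)
  have "(\<integral>t. \<bar>f t + g t\<bar> \<partial>M) \<le> (\<integral>t. \<bar>f t\<bar> + \<bar>g t\<bar> \<partial>M)"
    by (intro integral_mono) (use int in auto)
  then have "(\<integral>t. \<bar>f t + g t\<bar> \<partial>M) \<le> ?c"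
    using int norm_X_bounds(1)[OF f] norm_X_bounds(1)[OF g] by simp
  then show "vnorm X (cls (\<lambda>t. f t + g t)) \<le> ?c"
    using AE norm_X_nonneg[OF f] norm_X_nonneg[OF g] by (simp add: norm_X_le_iff[OF *])
qed

lemma coords_scale:
  assumes g: "g \<in> coords"
  shows "(\<lambda>t. a * g t) \<in> coords"
    and "vnorm X (cls (\<lambda>t. a * g t)) \<le> \<bar>a\<bar> * vnorm X (cls g)"
proof -
  have AE: "AE t in M. t \<in> \<Gamma> \<longrightarrow> \<bar>a * g t\<bar> * q t \<le> \<bar>a\<bar> * vnorm X (cls g)"
    using norm_X_bounds(2)[OF g]
    by eventually_elim (simp add: abs_mult mult.assoc mult_left_mono)
  then show *: "(\<lambda>t. a * g t) \<in> coords" using g by (auto simp: coords_def)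
  have "(\<integral>t. \<bar>a * g t\<bar> \<partial>M) \<le> \<bar>a\<bar> * vnorm X (cls g)"
    using norm_X_bounds(1)[OF g] by (simp add: abs_mult mult_left_mono)
  then show "vnorm X (cls (\<lambda>t. a * g t)) \<le> \<bar>a\<bar> * vnorm X (cls g)"
    using AE norm_X_nonneg[OF g] by (simp add: norm_X_le_iff[OF *])
qed

lemma zero_coords: "(\<lambda>t. 0) \<in> coords"
  by (auto simp: coords_def intro!: exI[of _ 0])

lemma operations_X:
  "vadd X = L0_add M" "vscale X = L0_scale M" "vzero X = cls (\<lambda>t. 0)"
  by (auto simp: L1_inter_Linf_def cls_def repr_def zero_ereal_def)

lemma L0_class_in_Y_iff:
  assumes "f \<in> borel_measurable M"
  shows "L0_class M f \<in> vecs Y \<longleftrightarrow> Linf_norm M (space M) v f < \<infinity>"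
  using assms by (simp add: Linf_space_def L0_class_in_Linf_set_iff)

lemma vecs_Y:
  assumes v': "weight_on M (space M) v"
  shows "vecs Y = cls ` {g \<in> borel_measurable M. \<exists>c. AE t in M. \<bar>g t\<bar> * q t \<le> c}"
proof -
  have *: "cls g \<in> vecs Y \<longleftrightarrow> (\<exists>c. AE t in M. \<bar>g t\<bar> * q t \<le> c)" if g: "g \<in> borel_measurable M" for g
    using Linf_norm_repr_finite_iff[OF sets.top v' g] g
    by (simp add: cls_def L0_class_in_Y_iff cong: AE_cong)
  show ?thesis
  proof
    show "vecs Y \<subseteq> cls ` {g \<in> borel_measurable M. \<exists>c. AE t in M. \<bar>g t\<bar> * q t \<le> c}"
    proof
      fix x assume x: "x \<in> vecs Y"
      then obtain f where f: "f \<in> borel_measurable M" "x = L0_class M f"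
        by (auto simp: Linf_space_def Linf_set_def)
      have "AE t in M. t \<in> space M \<longrightarrow> e2ennreal \<bar>f t * v t\<bar> \<le> Linf_norm M (space M) v f"
        using Linf_norm_le_iff[OF v_measurable f(1) sets.top] by blast
      then have "AE t in M. \<bar>f t\<bar> \<noteq> \<infinity>"
        using real_weight_eq_AE[OF v'] AE_space
      proof eventually_elim
        case (elim t)
        moreover have "Linf_norm M (space M) v f < \<infinity>" using x f L0_class_in_Y_iff by auto
        ultimately show ?case using real_weight_pos[of v t]
          by (cases "f t") (auto simp: top_unique)
      qed
      then obtain g where "g \<in> borel_measurable M" "L0_class M f = cls g"
        using L0_class_eq_cls[OF f(1)] by blast
      then show "x \<in> cls ` {g \<in> borel_measurable M. \<exists>c. AE t in M. \<bar>g t\<bar> * q t \<le> c}"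
        using x f * by auto
    qed
  qed (use * in auto)
qed

lemma norm_Y_cls:
  assumes g: "g \<in> borel_measurable M"
  shows "vnorm Y (cls g) = enn2real (Linf_norm M (space M) v (repr g))"
proof -
  let ?F = "\<lambda>f. enn2real (Linf_norm M (space M) v f)"
  have "vnorm Y (cls g) = L0_lift ?F (L0_class M (repr g))"
    by (simp add: Linf_space_def cls_def)
  also have "\<dots> = ?F (repr g)"
  proof (rule L0_lift_class)
    show "repr g \<in> borel_measurable M" using g by measurable
    fix h assume h: "h \<in> borel_measurable M" "AE t in M. repr g t = h t"
    have "AE t in M. t \<in> space M \<longrightarrow> repr g t = h t" using h(2) by eventually_elim simp
    then show "?F h = ?F (repr g)"
      using Linf_norm_cong_AE[OF v_measurable repr_measurable[OF g] h(1) sets.top] by simp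
  qed
  finally show ?thesis .
qed

lemma norm_Y_le_iff:
  assumes v': "weight_on M (space M) v" and g: "g \<in> borel_measurable M"
    and bdd: "\<exists>c. AE t in M. \<bar>g t\<bar> * q t \<le> c" and "0 \<le> c"
  shows "vnorm Y (cls g) \<le> c \<longleftrightarrow> (AE t in M. \<bar>g t\<bar> * q t \<le> c)"
proof -
  have "Linf_norm M (space M) v (repr g) < \<infinity>"
    using Linf_norm_repr_finite_iff[OF sets.top v' g] bdd by (simp cong: AE_cong)
  then show ?thesis
    using Linf_norm_repr_le_iff[OF sets.top v' g \<open>0 \<le> c\<close>] \<open>0 \<le> c\<close>
    by (simp add: norm_Y_cls[OF g] enn2real_le_iff_le_ennreal cong: AE_cong)
qed

section \<open>Small total weight ratio\<close>

lemma integrable_of_weighted_bound: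
  assumes le: "(\<integral>\<^sup>+ t. ennreal (1 / q t) \<partial>M) \<le> 1" and g: "g \<in> weighted_ball M q c"
    and "0 \<le> c"
  shows "integrable M g" "(\<integral>t. \<bar>g t\<bar> \<partial>M) \<le> c"
proof -
  have int: "integrable M (\<lambda>t. 1 / q t)"
    using le q_pos by (intro integrableI_nonneg) (auto simp: less_imp_le intro: le_less_trans)
  have "ennreal (\<integral>t. 1 / q t \<partial>M) = (\<integral>\<^sup>+ t. ennreal (1 / q t) \<partial>M)"
    using q_pos by (intro nn_integral_eq_integral[symmetric] int) (auto simp: less_imp_le)
  then have "(\<integral>t. 1 / q t \<partial>M) \<le> 1" using le by (metis ennreal_le_1)
  have [measurable]: "g \<in> borel_measurable M" using g by (simp add: weighted_ball_def)
  have bnd: "AE t in M. \<bar>g t\<bar> \<le> c * (1 / q t)"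
    using g q_pos by (auto simp: weighted_ball_def field_simps)
  show g_int: "integrable M g"
    by (rule Bochner_Integration.integrable_bound[of M "\<lambda>t. c * (1 / q t)"])
      (use integrable_mult_right[OF int] bnd \<open>0 \<le> c\<close> in
        \<open>auto elim!: eventually_mono simp: abs_of_pos[OF q_pos]\<close>)
  have "(\<integral>t. \<bar>g t\<bar> \<partial>M) \<le> (\<integral>t. c * (1 / q t) \<partial>M)"
    by (rule integral_mono_AE) (use g_int integrable_mult_right[OF int] bnd in auto)
  also have "\<dots> = c * (\<integral>t. 1 / q t \<partial>M)"
    by (rule integral_mult_right_zero)
  also have "\<dots> \<le> c"
    using \<open>(\<integral>t. 1 / q t \<partial>M) \<le> 1\<close> \<open>0 \<le> c\<close> by (simp add: mult_left_le)
  finally show "(\<integral>t. \<bar>g t\<bar> \<partial>M) \<le> c" .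
qed

lemma AE_in_\<Gamma>:
  assumes "emeasure M (space M - \<Gamma>) = 0"
  shows "AE t in M. t \<in> \<Gamma>"
proof -
  have "AE t in M. t \<notin> space M - \<Gamma>" by (rule AE_not_in) (use assms in auto)
  then show ?thesis using AE_space by eventually_elim auto
qed

lemma nn_integral_ratio:
  assumes "weight_on M (space M) v"
  shows "(\<integral>\<^sup>+ t. e2ennreal (w t / v t) \<partial>M) = (\<integral>\<^sup>+ t. ennreal (1 / q t) \<partial>M)"
proof (rule nn_integral_cong_AE)
  show "AE t in M. e2ennreal (w t / v t) = ennreal (1 / q t)"
    using real_weight_eq_AE[OF w] real_weight_eq_AE[OF assms] AE_space
  proof eventually_elim
    case (elim t)
    have "w t / v t = ereal (1 / q t)"
      using elim real_weight_pos[of v t] by (simp add: q_def)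
    then show ?case by simp
  qed
qed

lemma weight_on_space:
  assumes "emeasure M (space M - \<Gamma>) = 0"
  shows "weight_on M (space M) v"
  using v AE_in_\<Gamma>[OF assms] by (auto simp: weight_on_def elim: AE_mp)

text \<open>Here the integral half of the norm is redundant, because \<open>\<bar>g\<bar> \<le> c / q\<close> and
  \<open>1 / q\<close> has integral at most one.\<close>
lemma small_ratio_ball_iff:
  assumes null: "emeasure M (space M - \<Gamma>) = 0" and le: "(\<integral>\<^sup>+ t. ennreal (1 / q t) \<partial>M) \<le> 1"
  shows "g \<in> coords \<longleftrightarrow> (\<exists>c. g \<in> weighted_ball M q c)"
    and "g \<in> coords \<Longrightarrow> 0 \<le> c \<Longrightarrow> vnorm X (cls g) \<le> c \<longleftrightarrow> g \<in> weighted_ball M q c"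
proof -
  have \<Gamma>_iff: "(AE t in M. t \<in> \<Gamma> \<longrightarrow> P t) \<longleftrightarrow> (AE t in M. P t)" for P
    using AE_in_\<Gamma>[OF null] by (auto elim: AE_mp)
  show "g \<in> coords \<longleftrightarrow> (\<exists>c. g \<in> weighted_ball M q c)"
  proof
    assume "\<exists>c. g \<in> weighted_ball M q c"
    then obtain c where "g \<in> weighted_ball M q c" ..
    then have c: "g \<in> weighted_ball M q \<bar>c\<bar>"
      by (auto simp: weighted_ball_def elim!: eventually_mono)
    then show "g \<in> coords"
      using integrable_of_weighted_bound(1)[OF le c] by (auto simp: coords_def weighted_ball_def)
  qed (auto simp: coords_def weighted_ball_def \<Gamma>_iff)
  assume "g \<in> coords" "0 \<le> c"
  then show "vnorm X (cls g) \<le> c \<longleftrightarrow> g \<in> weighted_ball M q c"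
    using integrable_of_weighted_bound(2)[OF le, of g c]
    by (auto simp: norm_X_le_iff \<Gamma>_iff) (auto simp: weighted_ball_def coords_measurable)
qed

lemma X_eq_Y_if_small_ratio:
  assumes null: "emeasure M (space M - \<Gamma>) = 0" and le: "(\<integral>\<^sup>+ t. ennreal (1 / q t) \<partial>M) \<le> 1"
  shows "vecs X = vecs Y" "x \<in> vecs X \<Longrightarrow> vnorm X x = vnorm Y x"
proof -
  note v' = weight_on_space[OF null]
  note X_iff = small_ratio_ball_iff[OF null le]
  have coords: "coords = {g \<in> borel_measurable M. \<exists>c. AE t in M. \<bar>g t\<bar> * q t \<le> c}"
    using X_iff(1) by (auto simp: weighted_ball_def)
  show "vecs X = vecs Y" unfolding vecs_X vecs_Y[OF v'] coords ..
  assume "x \<in> vecs X"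
  then obtain g where x: "x = cls g" and g: "g \<in> coords" by (auto simp: vecs_X)
  have "vnorm X (cls g) \<le> c \<longleftrightarrow> vnorm Y (cls g) \<le> c" if "0 \<le> c" for c
    using norm_Y_le_iff[OF v', of g c] X_iff(2)[OF g that] g that
    by (auto simp: coords weighted_ball_def)
  moreover have "0 \<le> vnorm X (cls g)" "0 \<le> vnorm Y (cls g)"
    using g by (auto simp: norm_X_nonneg norm_Y_cls coords_measurable)
  ultimately show "vnorm X x = vnorm Y x" unfolding x by (metis antisym order_refl)
qed

text \<open>A rank one operator sends \<open>[g / w]\<close> to \<open>\<phi>(g)\<close> times a fixed vector.  Since that vector
  is not zero, the scalar \<open>\<phi>(g)\<close> is determined and inherits linearity and boundedness from the
  operator, and \<open>Daugavet_estimate\<close> applies.\<close>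
lemma Daugavet_if_small_ratio:
  assumes na: "non_atomic M"
    and null: "emeasure M (space M - \<Gamma>) = 0" and le: "(\<integral>\<^sup>+ t. ennreal (1 / q t) \<partial>M) \<le> 1"
  shows "Daugavet_property X"
  unfolding Daugavet_property_def
proof (intro allI impI)
  fix T assume "bounded_operator X T \<and> rank_one X T"
  then have bop: "bounded_operator X T" and rank: "rank_one X T" by auto
  note ball_iff = small_ratio_ball_iff[OF null le]
  have T_add: "T (cls (\<lambda>t. f t + g t)) = vadd X (T (cls f)) (T (cls g))"
    if "f \<in> coords" "g \<in> coords" for f g
  proof -
    have "T (vadd X (cls f) (cls g)) = vadd X (T (cls f)) (T (cls g))"
      using bop that unfolding bounded_operator_def vecs_X by blast
    then show ?thesis using that coords_measurable by (simp add: operations_X L0_add_cls)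
  qed
  have T_scale: "T (cls (\<lambda>t. a * g t)) = vscale X a (T (cls g))" if "g \<in> coords" for g a
  proof -
    have "T (vscale X a (cls g)) = vscale X a (T (cls g))"
      using bop that unfolding bounded_operator_def vecs_X by blast
    then show ?thesis using that coords_measurable by (simp add: operations_X L0_scale_cls)
  qed
  from rank obtain y where y: "y \<in> coords" "cls y \<noteq> vzero X"
    and range: "T ` vecs X = range (\<lambda>c. vscale X c (cls y))"
    unfolding rank_one_def vecs_X by blast
  note [measurable] = coords_measurable[OF y(1)]
  have scale_y: "vscale X a (cls y) = cls (\<lambda>t. a * y t)" for a
    by (simp add: operations_X L0_scale_cls)
  have y_nz: "\<not> (AE t in M. y t = 0)"
    using y(2) by (simp add: operations_X cls_eq_iff)
  have "\<forall>g\<in>coords. \<exists>a. T (cls g) = cls (\<lambda>t. a * y t)"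
  proof
    fix g assume "g \<in> coords"
    then have "T (cls g) \<in> range (\<lambda>c. vscale X c (cls y))"
      unfolding range[symmetric] vecs_X by blast
    then show "\<exists>a. T (cls g) = cls (\<lambda>t. a * y t)" by (auto simp: scale_y)
  qed
  then obtain \<phi> where \<phi>: "\<And>g. g \<in> coords \<Longrightarrow> T (cls g) = cls (\<lambda>t. \<phi> g * y t)" by metis
  have coeff_unique: "a = b" if "cls (\<lambda>t. a * y t) = cls (\<lambda>t. b * y t)" for a b
  proof (rule ccontr)
    assume "a \<noteq> b"
    have "AE t in M. a * y t = b * y t" using that by (subst (asm) cls_eq_iff) auto
    then have "AE t in M. y t = 0" by eventually_elim (use \<open>a \<noteq> b\<close> in auto)
    then show False using y_nz by simp
  qed
  have \<phi>_add: "\<phi> (\<lambda>t. f t + g t) = \<phi> f + \<phi> g" if "f \<in> coords" "g \<in> coords" for f g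
  proof (rule coeff_unique)
    show "cls (\<lambda>t. \<phi> (\<lambda>t. f t + g t) * y t) = cls (\<lambda>t. (\<phi> f + \<phi> g) * y t)"
      using T_add[OF that] \<phi>[OF that(1)] \<phi>[OF that(2)] \<phi>[OF coords_add(1)[OF that]]
      by (simp add: operations_X L0_add_cls distrib_right)
  qed
  have \<phi>_scale: "\<phi> (\<lambda>t. a * g t) = a * \<phi> g" if "g \<in> coords" for g a
  proof (rule coeff_unique)
    show "cls (\<lambda>t. \<phi> (\<lambda>t. a * g t) * y t) = cls (\<lambda>t. a * \<phi> g * y t)"
      using T_scale[OF that] \<phi>[OF that] \<phi>[OF coords_scale(1)[OF that]]
      by (simp add: operations_X L0_scale_cls mult.assoc)
  qed
  have "\<exists>K. \<forall>x\<in>vecs X. vnorm X (T x) \<le> K * vnorm X x"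
    using bop by (simp only: bounded_operator_def)
  then obtain K where "\<forall>x\<in>vecs X. vnorm X (T x) \<le> K * vnorm X x" ..
  then have K: "vnorm X (T (cls g)) \<le> K * vnorm X (cls g)" if "g \<in> coords" for g
    using that by (simp add: vecs_X)
  have T_le: "vnorm X (T (cls g)) \<le> \<bar>K\<bar>" if "g \<in> coords" "vnorm X (cls g) \<le> 1" for g
  proof -
    have "K * vnorm X (cls g) \<le> \<bar>K\<bar> * vnorm X (cls g)"
      by (rule mult_right_mono) (use norm_X_nonneg that in auto)
    also have "\<dots> \<le> \<bar>K\<bar>"
      using that norm_X_nonneg by (simp add: mult_left_le)
    finally show ?thesis using K[OF that(1)] by linarith
  qed
  define I_plus_T where "I_plus_T x = vadd X x (T x)" for x
  have IT: "I_plus_T (cls g) = cls (\<lambda>t. g t + \<phi> g * y t)" if "g \<in> coords" for g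
    using that coords_measurable by (simp add: I_plus_T_def operations_X \<phi> L0_add_cls)
  have IT_le: "vnorm X (I_plus_T (cls g)) \<le> 1 + vnorm X (T (cls g))"
    if "g \<in> coords" "vnorm X (cls g) \<le> 1" for g
    using coords_add(2)[OF that(1) coords_scale(1)[OF y(1)], of "\<phi> g"] that
    by (simp add: IT \<phi>)
  have zero: "vnorm X (cls (\<lambda>t. 0)) \<le> 1" "cls (\<lambda>t. 0) \<in> vecs X"
    using norm_X_le_iff[OF zero_coords, of 1] zero_coords by (auto simp: vecs_X)
  have T_upper: "vnorm X (T (cls g)) \<le> operator_norm X T"
    if "g \<in> coords" "vnorm X (cls g) \<le> 1" for g
    by (rule operator_norm_upper[where C = "\<bar>K\<bar>"]) (use that T_le in \<open>auto simp: vecs_X\<close>)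
  have IT_upper: "vnorm X (I_plus_T (cls g)) \<le> operator_norm X I_plus_T"
    if "g \<in> coords" "vnorm X (cls g) \<le> 1" for g
    by (rule operator_norm_upper[where C = "1 + \<bar>K\<bar>"])
      (use that IT_le T_le in \<open>force simp: vecs_X\<close>)+
  have "operator_norm X I_plus_T \<le> 1 + operator_norm X T"
    by (rule operator_norm_least[OF zero(2,1)]) (use IT_le T_upper in \<open>force simp: vecs_X\<close>)
  moreover have "1 + operator_norm X T \<le> operator_norm X I_plus_T"
  proof -
    let ?B = "operator_norm X I_plus_T"
    obtain c where c: "y \<in> weighted_ball M q c" using y(1) ball_iff(1) by blast
    obtain L where L: "\<And>f. f \<in> weighted_ball M q 1 \<Longrightarrow> \<bar>\<phi> f\<bar> \<le> L"
    proof -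
      \<comment> \<open>The norm of \<open>\<phi>(f) y\<close> is bounded on the ball, so it remains to divide by that of \<open>y\<close>.\<close>
      have "\<not> (AE t in M. \<bar>y t\<bar> * q t \<le> 0)"
      proof
        assume "AE t in M. \<bar>y t\<bar> * q t \<le> 0"
        then have "AE t in M. y t = 0"
        proof eventually_elim
          case (elim t)
          then show ?case using q_pos[of t] by (simp add: mult_le_0_iff)
        qed
        then show False using y_nz by simp
      qed
      then have ny: "0 < vnorm X (cls y)"
        using ball_iff(2)[OF y(1), of 0] by (auto simp: weighted_ball_def not_le)
      have "\<bar>\<phi> f\<bar> \<le> \<bar>K\<bar> / vnorm X (cls y)" if f: "f \<in> weighted_ball M q 1" for f
      proof -
        have fc: "f \<in> coords" using f ball_iff(1) by blast
        have f1: "vnorm X (cls f) \<le> 1" using f ball_iff(2)[OF fc, of 1] by simp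
        show ?thesis
        proof (cases "\<phi> f = 0")
          case True
          then show ?thesis using ny by simp
        next
          case False
          have "vnorm X (cls (\<lambda>t. 1 / \<phi> f * (\<phi> f * y t)))
              \<le> \<bar>1 / \<phi> f\<bar> * vnorm X (cls (\<lambda>t. \<phi> f * y t))"
            by (rule coords_scale(2)[OF coords_scale(1)[OF y(1)]])
          also have "\<dots> \<le> \<bar>1 / \<phi> f\<bar> * \<bar>K\<bar>"
            using T_le[OF fc f1] \<phi>[OF fc] by (intro mult_left_mono) auto
          finally show ?thesis using False ny by (simp add: field_simps)
        qed
      qed
      then show thesis using that by blast
    qed
    have upper: "AE t in M. \<bar>z t + \<phi> z * y t\<bar> * q t \<le> ?B" if z: "z \<in> weighted_ball M q 1" for z
    proof -
      have zc: "z \<in> coords" using z ball_iff(1) by blast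
      have z1: "vnorm X (cls z) \<le> 1" using z ball_iff(2)[OF zc, of 1] by simp
      have *: "(\<lambda>t. z t + \<phi> z * y t) \<in> coords"
        using coords_add(1)[OF zc coords_scale(1)[OF y(1)]] .
      have "vnorm X (cls (\<lambda>t. z t + \<phi> z * y t)) \<le> ?B" using IT_upper[OF zc z1] IT[OF zc] by simp
      then show ?thesis
        using ball_iff(2)[OF *, of ?B] norm_X_nonneg[OF *] by (simp add: weighted_ball_def)
    qed
    have "vnorm X (T (cls x)) \<le> ?B - 1" if x: "x \<in> coords" "vnorm X (cls x) \<le> 1" for x
    proof -
      have AE: "AE t in M. \<bar>\<phi> x * y t\<bar> * q t \<le> ?B - 1"
      proof (rule Daugavet_estimate[OF na q_measurable q_pos _ _ L c upper])
        show "\<phi> (\<lambda>t. f t + g t) = \<phi> f + \<phi> g"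
          if "f \<in> weighted_ball M q a" "g \<in> weighted_ball M q b" for f g a b
          using that ball_iff(1) by (intro \<phi>_add) blast+
        show "\<phi> (\<lambda>t. a * f t) = a * \<phi> f" if "f \<in> weighted_ball M q b" for f a b
          using that ball_iff(1) by (intro \<phi>_scale) blast+
        show "x \<in> weighted_ball M q 1" using x ball_iff(2)[OF x(1), of 1] by simp
      qed
      have "0 \<le> ?B - 1"
      proof (rule ccontr)
        assume neg: "\<not> ?thesis"
        have "AE t in M. False"
          using AE
        proof eventually_elim
          case (elim t)
          have "0 \<le> \<bar>\<phi> x * y t\<bar> * q t" using q_pos[of t] by simp
          then show ?case using elim neg by linarith
        qed
        then have "AE t in M. y t = 0" by eventually_elim simp
        then show False using y_nz by simp
      qed
      then show ?thesis
        using AE ball_iff(2)[OF coords_scale(1)[OF y(1)], of "?B - 1" "\<phi> x"] \<phi>[OF x(1)]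
        by (simp add: weighted_ball_def)
    qed
    then have "operator_norm X T \<le> ?B - 1"
      by (intro operator_norm_least[OF zero(2,1)]) (auto simp: vecs_X)
    then show ?thesis by simp
  qed
  ultimately show "operator_norm X (\<lambda>x. vadd X x (T x)) = 1 + operator_norm X T"
    by (simp add: I_plus_T_def[abs_def])
qed

section \<open>Equality with the weighted space of bounded functions\<close>

text \<open>Two test functions suffice: \<open>1 / q\<close> bounds the integral, and its restriction to the
  complement of \<open>\<Gamma>\<close> shows that the complement is null.\<close>
lemma small_ratio_if_X_eq_Y:
  assumes pos: "emeasure M \<Gamma> > 0" and v': "weight_on M (space M) v"
    and eq: "vecs X = vecs Y" "\<And>x. x \<in> vecs X \<Longrightarrow> vnorm X x = vnorm Y x"
  shows "emeasure M (space M - \<Gamma>) = 0" "(\<integral>\<^sup>+ t. ennreal (1 / q t) \<partial>M) \<le> 1"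
proof -
  have X_iff: "g \<in> coords \<and> (\<integral>t. \<bar>g t\<bar> \<partial>M) \<le> vnorm Y (cls g)
      \<and> (\<forall>c\<ge>0. (\<integral>t. \<bar>g t\<bar> \<partial>M) \<le> c \<longrightarrow> (AE t in M. t \<in> \<Gamma> \<longrightarrow> \<bar>g t\<bar> * q t \<le> c) \<longrightarrow>
            vnorm Y (cls g) \<le> c)"
    if g: "g \<in> borel_measurable M" "AE t in M. \<bar>g t\<bar> * q t \<le> c" for g c
  proof -
    have gX: "cls g \<in> vecs X" using eq(1) g by (auto simp: vecs_Y[OF v'])
    then have gc: "g \<in> coords" using cls_in_X_iff[OF g(1)] by simp
    then show ?thesis using eq(2)[OF gX] norm_X_le_iff[OF gc] norm_X_bounds(1)[OF gc] by simp
  qed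
  define h where "h t = 1 / q t" for t
  have h_pos: "h t > 0" for t using q_pos[of t] by (simp add: h_def)
  have h_meas [measurable]: "h \<in> borel_measurable M" unfolding h_def by measurable
  have hq: "AE t in M. \<bar>h t\<bar> * q t \<le> 1"
    using q_pos by (auto simp: h_def less_imp_neq[symmetric])
  have h: "h \<in> coords" "(\<integral>t. \<bar>h t\<bar> \<partial>M) \<le> 1"
    using X_iff[OF h_meas hq] norm_Y_le_iff[OF v' h_meas, of 1] hq by force+
  have int: "integrable M h" using h(1) by (simp add: coords_def)
  have "(\<integral>\<^sup>+ t. ennreal (h t) \<partial>M) = ennreal (\<integral>t. h t \<partial>M)"
    using h_pos by (intro nn_integral_eq_integral int) (auto simp: less_imp_le)
  moreover have h_le: "(\<integral>t. h t \<partial>M) \<le> 1" using h(2) h_pos by (simp add: less_imp_le)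
  ultimately show "(\<integral>\<^sup>+ t. ennreal (1 / q t) \<partial>M) \<le> 1" by (simp add: h_def)
  \<comment> \<open>The part of \<open>h\<close> off \<open>\<Gamma>\<close> has integral below one, because \<open>\<Gamma>\<close> carries some of the mass.\<close>
  define k where "k t = indicator (space M - \<Gamma>) t * h t" for t
  have k_meas [measurable]: "k \<in> borel_measurable M" unfolding k_def by measurable
  have kq: "AE t in M. \<bar>k t\<bar> * q t \<le> 1"
    using hq by eventually_elim (auto simp: k_def indicator_def)
  have int_\<Gamma>: "integrable M (\<lambda>t. indicator \<Gamma> t * h t)"
    using integrable_mult_indicator[OF \<Gamma> int] by simp
  have int_k: "integrable M k"
    using integrable_mult_indicator[of "space M - \<Gamma>" M h] int by (simp add: k_def[abs_def])
  have "(\<integral>t. indicator \<Gamma> t * h t \<partial>M) \<noteq> 0"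
  proof
    assume "(\<integral>t. indicator \<Gamma> t * h t \<partial>M) = 0"
    then have "AE t in M. indicator \<Gamma> t * h t = 0"
      using h_pos by (subst (asm) integral_nonneg_eq_0_iff_AE[OF int_\<Gamma>]) (auto simp: less_imp_le)
    then have "AE t in M. t \<notin> \<Gamma>"
      by eventually_elim (use h_pos in \<open>auto simp: less_imp_neq[symmetric]\<close>)
    then have "emeasure M \<Gamma> = 0"
      using AE_iff_null_sets[OF \<Gamma>] by (auto dest: null_setsD1)
    then show False using pos by simp
  qed
  moreover have "0 \<le> (\<integral>t. indicator \<Gamma> t * h t \<partial>M)"
    using h_pos by (intro integral_nonneg_AE) (auto simp: less_imp_le)
  moreover have "(\<integral>t. h t \<partial>M) = (\<integral>t. indicator \<Gamma> t * h t + k t \<partial>M)"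
    by (rule Bochner_Integration.integral_cong) (auto simp: k_def indicator_def)
  ultimately have k_lt: "(\<integral>t. k t \<partial>M) < 1" using int_\<Gamma> int_k h_le by simp
  have k_nonneg: "0 \<le> k t" for t using h_pos[of t] by (simp add: k_def indicator_def)
  define c where "c = (\<integral>t. k t \<partial>M)"
  have "0 \<le> c" unfolding c_def using k_nonneg by (intro integral_nonneg_AE) auto
  have "vnorm Y (cls k) \<le> c"
  proof -
    have "(\<integral>t. \<bar>k t\<bar> \<partial>M) \<le> c" using k_nonneg by (simp add: c_def)
    moreover have "AE t in M. t \<in> \<Gamma> \<longrightarrow> \<bar>k t\<bar> * q t \<le> c"
      using \<open>0 \<le> c\<close> by (simp add: k_def)
    ultimately show ?thesis using X_iff[OF k_meas kq] \<open>0 \<le> c\<close> by blast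
  qed
  then have "AE t in M. \<bar>k t\<bar> * q t \<le> c"
    using norm_Y_le_iff[OF v' k_meas _ \<open>0 \<le> c\<close>] kq by blast
  then have "AE t in M. t \<notin> space M - \<Gamma>"
  proof eventually_elim
    case (elim t)
    show ?case
    proof
      assume "t \<in> space M - \<Gamma>"
      then have "\<bar>k t\<bar> * q t = 1" using q_pos[of t] by (simp add: k_def h_def)
      then show False using elim k_lt by (simp add: c_def)
    qed
  qed
  then show "emeasure M (space M - \<Gamma>) = 0"
    using AE_iff_null_sets[of "space M - \<Gamma>" M] by (auto dest: null_setsD1)
qed

section \<open>Failure of the Daugavet property\<close>

text \<open>The truncations \<open>min r (n h)\<close> of the extremal function \<open>r\<close> by multiples of a strictly
  positive integrable \<open>h\<close> increase to \<open>r\<close>, so one of them has a finite integral above one.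
  Dividing by that integral pushes the supremum norm on \<open>\<Gamma>\<close> below one.\<close>
lemma exists_flat_unit_function:
  assumes not_small: "\<not> (emeasure M (space M - \<Gamma>) = 0 \<and> (\<integral>\<^sup>+ t. ennreal (1 / q t) \<partial>M) \<le> 1)"
  obtains y s where "integrable M y" "\<And>t. 0 \<le> y t" "(\<integral>t. y t \<partial>M) = 1"
    "\<And>t. t \<in> \<Gamma> \<Longrightarrow> y t * q t \<le> s" "0 \<le> s" "s < 1" "\<And>t. t \<in> \<Gamma> \<Longrightarrow> 0 < y t"
proof -
  define r where "r t = (if t \<in> \<Gamma> then ennreal (1 / q t) else \<infinity>)" for t
  have r_meas [measurable]: "r \<in> borel_measurable M" unfolding r_def by measurable
  have "1 < (\<integral>\<^sup>+ t. r t \<partial>M)"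
  proof (cases "emeasure M (space M - \<Gamma>) = 0")
    case True
    have "(\<integral>\<^sup>+ t. r t \<partial>M) = (\<integral>\<^sup>+ t. ennreal (1 / q t) \<partial>M)"
      by (rule nn_integral_cong_AE) (use AE_in_\<Gamma>[OF True] in eventually_elim, simp add: r_def)
    then show ?thesis using not_small True by (simp add: not_le)
  next
    case False
    have "(\<integral>\<^sup>+ t. \<infinity> * indicator (space M - \<Gamma>) t \<partial>M) \<le> (\<integral>\<^sup>+ t. r t \<partial>M)"
      by (rule nn_integral_mono) (auto simp: r_def indicator_def)
    moreover have "(\<integral>\<^sup>+ t. \<infinity> * indicator (space M - \<Gamma>) t \<partial>M) = \<infinity> * emeasure M (space M - \<Gamma>)"
      by (rule nn_integral_cmult_indicator) simp
    ultimately show ?thesis using False by (simp add: ennreal_top_mult top_unique)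
  qed
  obtain h where h [measurable]: "h \<in> borel_measurable M" and h_fin: "integral\<^sup>N M h \<noteq> \<infinity>"
    and h_pos: "\<And>t. t \<in> space M \<Longrightarrow> 0 < h t \<and> h t < \<infinity>"
    using Ex_finite_integrable_function by blast
  define m where "m n t = min (r t) (of_nat (Suc n) * h t)" for n t
  have m_meas [measurable]: "m n \<in> borel_measurable M" for n unfolding m_def by measurable
  have sup: "(SUP n. m n t) = r t" if "t \<in> space M" for t
  proof -
    have "(SUP n. of_nat (Suc n) * h t) = (SUP n. of_nat (Suc n)) * h t"
      by (rule SUP_mult_right_ennreal[symmetric])
    also have "(SUP n. of_nat (Suc n) :: ennreal) = top"
    proof -
      have "(SUP n. of_nat n :: ennreal) \<le> (SUP n. of_nat (Suc n))"
        by (rule SUP_mono) (metis UNIV_I lessI less_imp_le of_nat_mono)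
      then show ?thesis by (simp add: ennreal_SUP_of_nat_eq_top top_unique)
    qed
    finally have "(SUP n. of_nat (Suc n) * h t) = top"
      using h_pos[OF that] by (auto simp: ennreal_top_mult)
    moreover have "(SUP n. m n t) = inf (r t) (SUP n. of_nat (Suc n) * h t)"
      unfolding m_def inf_SUP by (simp add: inf_min)
    ultimately show ?thesis by (simp only: inf_top_right)
  qed
  have "(\<integral>\<^sup>+ t. r t \<partial>M) = (\<integral>\<^sup>+ t. (SUP n. m n t) \<partial>M)"
    by (rule nn_integral_cong) (simp add: sup)
  also have "\<dots> = (SUP n. integral\<^sup>N M (m n))"
  proof (rule nn_integral_monotone_convergence_SUP)
    show "incseq m"
      unfolding m_def incseq_def le_fun_def
      by (intro allI impI min.mono mult_right_mono of_nat_mono) auto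
  qed simp
  finally have "1 < (SUP n. integral\<^sup>N M (m n))" using \<open>1 < _\<close> by simp
  then obtain n where n: "1 < integral\<^sup>N M (m n)" by (auto simp: less_SUP_iff)
  have "integral\<^sup>N M (m n) \<le> (\<integral>\<^sup>+ t. of_nat (Suc n) * h t \<partial>M)"
    unfolding m_def by (intro nn_integral_mono) auto
  also have "\<dots> = of_nat (Suc n) * integral\<^sup>N M h"
    by (rule nn_integral_cmult) simp
  also have "\<dots> < \<infinity>"
    using h_fin by (simp add: ennreal_mult_less_top less_top of_nat_less_top del: of_nat_Suc)
  finally have fin: "integral\<^sup>N M (m n) < \<infinity>" .
  \<comment> \<open>Outside the space any nonnegative value will do, as the integrals do not see it.\<close>
  define y0 where "y0 t = (if t \<in> space M then enn2real (m n t) else 1)" for t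
  have "m n t < \<infinity>" if "t \<in> space M" for t
    using h_pos[OF that]
    by (simp add: m_def min_less_iff_disj ennreal_mult_less_top less_top of_nat_less_top del: of_nat_Suc)
  then have y0_eq: "ennreal (y0 t) = m n t" if "t \<in> space M" for t
    using that by (simp add: y0_def)
  have [measurable]: "y0 \<in> borel_measurable M" unfolding y0_def by measurable
  have y0_nonneg: "0 \<le> y0 t" for t by (simp add: y0_def)
  have int_eq: "(\<integral>\<^sup>+ t. ennreal (y0 t) \<partial>M) = integral\<^sup>N M (m n)"
    by (rule nn_integral_cong) (rule y0_eq)
  have int: "integrable M y0"
    using fin y0_nonneg int_eq by (intro integrableI_nonneg) auto
  have "ennreal (\<integral>t. y0 t \<partial>M) = integral\<^sup>N M (m n)"
    using nn_integral_eq_integral[OF int] y0_nonneg int_eq by simp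
  then have I: "1 < (\<integral>t. y0 t \<partial>M)" using n by (metis ennreal_less_one_iff ennreal_le_1 not_le)
  have \<Gamma>_space: "t \<in> space M" if "t \<in> \<Gamma>" for t using that sets.sets_into_space[OF \<Gamma>] by blast
  have y0_pos: "0 < y0 t" if "t \<in> \<Gamma>" for t
  proof -
    have "0 < m n t"
      using h_pos[OF \<Gamma>_space[OF that]] q_pos[of t] that
      by (simp add: m_def r_def ennreal_zero_less_mult_iff del: of_nat_Suc)
    then show ?thesis using y0_eq[OF \<Gamma>_space[OF that]] by (metis ennreal_less_zero_iff)
  qed
  have y0_le: "y0 t * q t \<le> 1" if "t \<in> \<Gamma>" for t
  proof -
    have "ennreal (y0 t) \<le> ennreal (1 / q t)"
      using y0_eq[OF \<Gamma>_space[OF that]] that by (simp add: m_def r_def)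
    then have "y0 t \<le> 1 / q t" using q_pos[of t] by (simp add: ennreal_le_iff)
    then show ?thesis using q_pos[of t] by (simp add: field_simps)
  qed
  let ?I = "\<integral>t. y0 t \<partial>M"
  show thesis
  proof (rule that[of "\<lambda>t. y0 t / ?I" "1 / ?I"])
    show "y0 t / ?I * q t \<le> 1 / ?I" if "t \<in> \<Gamma>" for t
      using y0_le[OF that] I by (simp add: divide_right_mono)
  qed (use I int y0_nonneg y0_pos in auto)
qed

text \<open>The operator \<open>g \<mapsto> - p(g) y\<close> with \<open>p(g) = \<integral>\<^sub>\<Gamma> g y q\<close> is a
  counterexample.  The kernel \<open>y q\<close> makes \<open>p\<close> bounded, and positivity of \<open>y\<close> on the nonnull set
  \<open>\<Gamma>\<close> makes it nonzero.\<close>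
lemma not_Daugavet:
  assumes pos: "emeasure M \<Gamma> > 0"
    and y: "integrable M y" "\<And>t. 0 \<le> y t" "(\<integral>t. y t \<partial>M) = 1"
    and yq: "\<And>t. t \<in> \<Gamma> \<Longrightarrow> y t * q t \<le> s" and s: "0 \<le> s" "s < 1"
    and y_pos: "\<And>t. t \<in> \<Gamma> \<Longrightarrow> 0 < y t"
  shows "\<not> Daugavet_property X"
proof
  assume Daugavet: "Daugavet_property X"
  have [measurable]: "y \<in> borel_measurable M" using y(1) by simp
  have yc: "y \<in> coords"
    using y yq by (auto simp: coords_def)
  have y_norm: "1 \<le> vnorm X (cls y)" "vnorm X (cls y) \<le> 1"
    using norm_X_bounds(1)[OF yc] norm_X_le_iff[OF yc, of 1] y yq s by (force intro!: AE_I2)+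
  define p where "p g = (\<integral>t. indicator \<Gamma> t * (g t * y t * q t) \<partial>M)" for g
  have kernel: "\<bar>indicator \<Gamma> t * (g t * y t * q t)\<bar> \<le> s * \<bar>g t\<bar>" for g :: "'a \<Rightarrow> real" and t
  proof (cases "t \<in> \<Gamma>")
    case True
    then have "\<bar>g t\<bar> * (y t * q t) \<le> \<bar>g t\<bar> * s" using yq by (intro mult_left_mono) auto
    then show ?thesis using True y(2)[of t] q_pos[of t] by (simp add: abs_mult mult_ac)
  qed (use s in simp)
  have int: "integrable M (\<lambda>t. indicator \<Gamma> t * (g t * y t * q t))" if "g \<in> coords" for g
  proof (rule Bochner_Integration.integrable_bound)
    note [measurable] = coords_measurable[OF that]
    show "(\<lambda>t. indicator \<Gamma> t * (g t * y t * q t)) \<in> borel_measurable M" by measurable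
    show "integrable M (\<lambda>t. s * \<bar>g t\<bar>)" using that by (auto simp: coords_def)
    show "AE t in M. norm (indicator \<Gamma> t * (g t * y t * q t)) \<le> norm (s * \<bar>g t\<bar>)"
      using kernel[of _ g] s by (auto simp: abs_mult)
  qed
  have p_le: "\<bar>p g\<bar> \<le> s * vnorm X (cls g)" if "g \<in> coords" for g
  proof -
    have "\<bar>p g\<bar> \<le> (\<integral>t. \<bar>indicator \<Gamma> t * (g t * y t * q t)\<bar> \<partial>M)"
      unfolding p_def by (rule integral_abs_bound)
    also have "\<dots> \<le> (\<integral>t. s * \<bar>g t\<bar> \<partial>M)"
      by (intro integral_mono kernel integrable_abs int that) (use that in \<open>auto simp: coords_def\<close>)
    also have "\<dots> \<le> s * vnorm X (cls g)"
      using norm_X_bounds(1)[OF that] s by (simp add: mult_left_mono)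
    finally show ?thesis .
  qed
  have p_add: "p (\<lambda>t. f t + g t) = p f + p g" if "f \<in> coords" "g \<in> coords" for f g
    using int[OF that(1)] int[OF that(2)] unfolding p_def
    by (simp add: algebra_simps flip: Bochner_Integration.integral_add)
  have p_scale: "p (\<lambda>t. a * g t) = a * p g" for a g
  proof -
    have "(\<lambda>t. indicator \<Gamma> t * (a * g t * y t * q t))
        = (\<lambda>t. a * (indicator \<Gamma> t * (g t * y t * q t)))" by (simp add: mult_ac)
    then show ?thesis unfolding p_def by simp
  qed
  have p_cong: "p f = p g" if "cls f = cls g" "f \<in> coords" "g \<in> coords" for f g
  proof -
    note [measurable] = coords_measurable[OF that(2)] coords_measurable[OF that(3)]
    have "AE t in M. f t = g t" using that by (simp add: cls_eq_iff coords_measurable)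
    then show ?thesis unfolding p_def by (intro integral_cong_AE) (auto elim!: eventually_mono)
  qed
  have py: "0 < p y"
  proof -
    have ge: "0 \<le> indicator \<Gamma> t * (y t * y t * q t)" for t using y(2) q_pos[of t] by simp
    have "p y \<noteq> 0"
    proof
      assume "p y = 0"
      then have "AE t in M. indicator \<Gamma> t * (y t * y t * q t) = 0"
        unfolding p_def using integral_nonneg_eq_0_iff_AE[OF int[OF yc]] ge by simp
      then have "AE t in M. t \<notin> \<Gamma>"
      proof eventually_elim
        case (elim t)
        then show ?case using y_pos[of t] q_pos[of t] by auto
      qed
      then show False using AE_iff_null_sets[OF \<Gamma>] pos by (auto dest: null_setsD1)
    qed
    moreover have "0 \<le> p y" unfolding p_def using ge by (intro integral_nonneg_AE) auto
    ultimately show ?thesis by simp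
  qed
  \<comment> \<open>The functional is defined on classes through a chosen representative; it does not depend on
    the choice.\<close>
  define rep where "rep x = (SOME g. g \<in> coords \<and> x = cls g)" for x
  define T where "T x = vscale X (- p (rep x)) (cls y)" for x
  have T: "T (cls g) = cls (\<lambda>t. - p g * y t)" if "g \<in> coords" for g
  proof -
    have "rep (cls g) \<in> coords \<and> cls g = cls (rep (cls g))"
      unfolding rep_def
      by (rule someI[of "\<lambda>h. h \<in> coords \<and> cls g = cls h" g]) (use that in simp)
    then have "p (rep (cls g)) = p g" using p_cong that by metis
    then show ?thesis by (simp add: T_def operations_X L0_scale_cls)
  qed
  have Tn: "vnorm X (T (cls g)) = \<bar>p g\<bar>" if "g \<in> coords" for g
  proof (rule antisym)
    show "vnorm X (T (cls g)) \<le> \<bar>p g\<bar>"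
      using coords_scale(2)[OF yc, of "- p g"] y_norm T[OF that] by simp
    have "(\<integral>t. \<bar>- p g * y t\<bar> \<partial>M) = \<bar>p g\<bar>" using y by (simp add: abs_mult)
    then show "\<bar>p g\<bar> \<le> vnorm X (T (cls g))"
      using norm_X_bounds(1)[OF coords_scale(1)[OF yc, of "- p g"]] T[OF that] by simp
  qed
  have T_mem: "T (cls g) \<in> vecs X" if "g \<in> coords" for g
    using T[OF that] coords_scale(1)[OF yc, of "- p g"] by (auto simp: vecs_X)
  have bop: "bounded_operator X T"
    unfolding bounded_operator_def vecs_X
  proof (intro conjI ballI allI exI; clarify)
    fix f g a assume f: "f \<in> coords" and g: "g \<in> coords"
    show "T (vadd X (cls f) (cls g)) = vadd X (T (cls f)) (T (cls g))"
      using f g coords_add(1)[OF f g]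
      by (simp add: operations_X L0_add_cls coords_measurable T p_add left_diff_distrib)
  next
    fix g a assume g: "g \<in> coords"
    show "T (vscale X a (cls g)) = vscale X a (T (cls g))"
      using g coords_scale(1)[OF g, of a]
      by (simp add: operations_X L0_scale_cls coords_measurable T p_scale mult.assoc)
    show "T (cls g) \<in> cls ` coords" using T_mem[OF g] by (simp add: vecs_X)
    show "vnorm X (T (cls g)) \<le> s * vnorm X (cls g)" using Tn[OF g] p_le[OF g] by simp
  qed
  have rank: "rank_one X T"
    unfolding rank_one_def
  proof (intro bexI conjI)
    show "cls y \<in> vecs X" using yc by (simp add: vecs_X)
    show "cls y \<noteq> vzero X"
    proof
      assume "cls y = vzero X"
      then have "AE t in M. y t = 0" by (simp add: operations_X cls_eq_iff)
      then have "(\<integral>t. y t \<partial>M) = (\<integral>t. 0 \<partial>M)" by (intro integral_cong_AE) auto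
      then show False using y(3) by simp
    qed
    show "T ` vecs X = range (\<lambda>c. vscale X c (cls y))"
    proof
      show "T ` vecs X \<subseteq> range (\<lambda>c. vscale X c (cls y))" by (auto simp: T_def)
      show "range (\<lambda>c. vscale X c (cls y)) \<subseteq> T ` vecs X"
      proof clarify
        fix c
        let ?g = "\<lambda>t. - c / p y * y t"
        have "?g \<in> coords" by (rule coords_scale(1)[OF yc])
        moreover have "p ?g = - c" using p_scale[of "- c / p y" y] py by simp
        ultimately have "vscale X c (cls y) = T (cls ?g)"
          using T by (simp add: operations_X L0_scale_cls)
        then show "vscale X c (cls y) \<in> T ` vecs X"
          using \<open>?g \<in> coords\<close> by (auto simp: vecs_X)
      qed
    qed
  qed
  define P where "P = operator_norm X T"
  have T_upper: "\<bar>p g\<bar> \<le> P" if "g \<in> coords" "vnorm X (cls g) \<le> 1" for g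
  proof -
    have "vnorm X (T (cls g)) \<le> P"
      unfolding P_def
    proof (rule operator_norm_upper[where C = s])
      fix z assume "z \<in> vecs X" "vnorm X z \<le> 1"
      then obtain h where h: "z = cls h" "h \<in> coords" "vnorm X (cls h) \<le> 1" by (auto simp: vecs_X)
      then have "s * vnorm X (cls h) \<le> s" using s by (simp add: mult_left_le)
      then show "vnorm X (T z) \<le> s" using Tn[OF h(2)] p_le[OF h(2)] h(1) by simp
    qed (use that in \<open>auto simp: vecs_X\<close>)
    then show ?thesis using Tn that by simp
  qed
  have P_pos: "0 < P" using T_upper[OF yc y_norm(2)] py by simp
  define R where "R = 1 + max (P * s) (max (P / 2) (P - P\<^sup>2 / 2))"
  have nonneg_case: "vnorm X (cls (\<lambda>t. g t - p g * y t)) \<le> R"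
    if g: "g \<in> coords" "vnorm X (cls g) \<le> 1" and p0: "0 \<le> p g" for g
  proof -
    have mem: "(\<lambda>t. g t - p g * y t) \<in> coords"
      using coords_add(1)[OF g(1) coords_scale(1)[OF yc, of "- p g"]] by simp
    have gb: "integrable M g" "(\<integral>t. \<bar>g t\<bar> \<partial>M) \<le> 1" "AE t in M. t \<in> \<Gamma> \<longrightarrow> \<bar>g t\<bar> * q t \<le> 1"
      using g norm_X_le_iff[OF g(1), of 1] by (auto simp: coords_def)
    have "p g \<le> P" using T_upper[OF g] by simp
    have "s * vnorm X (cls g) \<le> 1 * 1" using g s norm_X_nonneg by (intro mult_mono) auto
    then have "p g \<le> 1" using p_le[OF g(1)] by simp
    note est = subtract_functional_multiple_estimate[OF \<Gamma> q_measurable q_pos gb y(1,2,3) _ _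
        int[OF g(1)] p_def p0 \<open>p g \<le> 1\<close>, of s]
    note gap = perturbation_gap[OF P_pos p0 \<open>p g \<le> P\<close> s(1), folded R_def]
    have "0 \<le> R" using P_pos by (simp add: R_def)
    have "AE t in M. t \<in> \<Gamma> \<longrightarrow> \<bar>g t - p g * y t\<bar> * q t \<le> R"
      using est(2) yq s gap by (auto elim!: eventually_mono)
    moreover have "(\<integral>t. \<bar>g t - p g * y t\<bar> \<partial>M) \<le> R"
      using est(1) yq s gap by auto
    ultimately show ?thesis using norm_X_le_iff[OF mem \<open>0 \<le> R\<close>] by simp
  qed
  have IT: "vnorm X (vadd X (cls g) (T (cls g))) \<le> R" if g: "g \<in> coords" "vnorm X (cls g) \<le> 1" for g
  proof -
    have eq: "vadd X (cls g) (T (cls g)) = cls (\<lambda>t. g t - p g * y t)"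
      using T[OF g(1)] coords_measurable[OF g(1)] by (simp add: operations_X L0_add_cls)
    show ?thesis
    proof (cases "0 \<le> p g")
      case True
      then show ?thesis unfolding eq by (rule nonneg_case[OF g])
    next
      case False
      let ?h = "\<lambda>t. - 1 * g t"
      have h: "?h \<in> coords" "vnorm X (cls ?h) \<le> 1"
        using coords_scale[OF g(1), of "- 1"] g(2) by simp_all
      have ph: "p ?h = - p g" using p_scale[of "- 1" g] by simp
      have mem: "(\<lambda>t. ?h t - p ?h * y t) \<in> coords"
        using coords_add(1)[OF h(1) coords_scale(1)[OF yc, of "- p ?h"]] by simp
      have "vnorm X (cls (\<lambda>t. ?h t - p ?h * y t)) \<le> R"
        by (rule nonneg_case[OF h]) (use ph False in simp)
      moreover have "(\<lambda>t. g t - p g * y t) = (\<lambda>t. - 1 * (?h t - p ?h * y t))"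
        unfolding ph by auto
      ultimately show ?thesis
        unfolding eq using coords_scale(2)[OF mem, of "- 1"] by simp
    qed
  qed
  have "operator_norm X (\<lambda>x. vadd X x (T x)) \<le> R"
  proof (rule operator_norm_least)
    show "cls (\<lambda>t. 0) \<in> vecs X" "vnorm X (cls (\<lambda>t. 0)) \<le> 1"
      using norm_X_le_iff[OF zero_coords, of 1] zero_coords by (auto simp: vecs_X)
  qed (use IT in \<open>auto simp: vecs_X\<close>)
  moreover have "operator_norm X (\<lambda>x. vadd X x (T x)) = 1 + P"
    using Daugavet bop rank unfolding Daugavet_property_def P_def by blast
  moreover have "R < 1 + P"
    using P_pos s by (simp add: R_def)
  ultimately show False by simp
qed

end

section \<open>The characterization\<close>

theorem theorem3p7:
  fixes M :: "'a measure" and \<Gamma> :: "'a set" and v w :: "'a \<Rightarrow> ereal"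
  assumes "sigma_finite_measure M" and "complete_measure M" and "non_atomic M"
    and "\<Gamma> \<in> sets M" and "emeasure M \<Gamma> > 0"
    and "weight_on M \<Gamma> v" and "weight_on M (space M) w"
  defines "X \<equiv> L1_inter_Linf M \<Gamma> w v"
    and "Y \<equiv> Linf_space M (space M) v"
  shows "(Daugavet_property X \<longleftrightarrow>
            weight_on M (space M) v \<and> vecs X = vecs Y \<and> (\<forall>x\<in>vecs X. vnorm X x = vnorm Y x))
       \<and> (Daugavet_property X \<longleftrightarrow>
            emeasure M (space M - \<Gamma>) = 0 \<and> (\<integral>\<^sup>+ t. e2ennreal (w t / v t) \<partial>M) \<le> 1)"
proof -
  interpret weighted_intersection M \<Gamma> v w
    using assms(1,4,6,7)
    by (simp add: weighted_intersection_def weighted_intersection_axioms_def)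
  let ?small = "emeasure M (space M - \<Gamma>) = 0 \<and> (\<integral>\<^sup>+ t. ennreal (1 / q t) \<partial>M) \<le> 1"
  have "Daugavet_property X \<longleftrightarrow> ?small"
  proof
    assume "Daugavet_property X"
    then show ?small
      unfolding X_def by (metis exists_flat_unit_function not_Daugavet[OF assms(5)])
  next
    assume ?small
    then show "Daugavet_property X"
      unfolding X_def using Daugavet_if_small_ratio[OF assms(3)] by blast
  qed
  moreover have "weight_on M (space M) v \<and> vecs X = vecs Y \<and> (\<forall>x\<in>vecs X. vnorm X x = vnorm Y x)
      \<longleftrightarrow> ?small"
    using small_ratio_if_X_eq_Y[OF assms(5)] X_eq_Y_if_small_ratio weight_on_space
    unfolding X_def Y_def by blast
  moreover have "emeasure M (space M - \<Gamma>) = 0 \<and> (\<integral>\<^sup>+ t. e2ennreal (w t / v t) \<partial>M) \<le> 1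
      \<longleftrightarrow> ?small"
    using nn_integral_ratio[OF weight_on_space] by auto
  ultimately show ?thesis by simp
qed

end
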